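(* Let $K$ be a hyperbolic knot in a closed orientable 3-manifold $M$, let $h$ be the hyperbolic metric of $N=M\setminus K$, let $J=J_h$ be the Sasakian almost complex structure of $h$ on $T^*N$, and let $T\subset N$ be a horo-torus. Consider the kinetic energy Hamiltonian $H_h(q,p)=\frac12|p|_h^2$ and the associated perturbed Cauchy-Riemann equations $(du-X_{H_h}\otimes\beta)^{(0,1)}=0$ with boundary condition given by the conormal $\nu^*T$. Let $\widetilde{\mathfrak m}=\{\widetilde{\mathfrak m}^k\}_{k=1}^\infty$ be the corresponding $A_\infty$ maps on the reduced wrapped Floer complex $\widetilde{CW}^*(\nu^*T;H_h)$. Then $\widetilde{\mathfrak m}^k=0$ for all $k\ne 2$.
   Context: Horo-torus: with universal cover $\mathbb H^3=\{(x,y,z):z>0\}$ of $N$, metric $(dx^2+dy^2+dz^2)/z^2$ and the cusp at $\infty$, a horo-torus is the embedded torus that is the image of a horosphere $\{z=z_0\}$, $z_0$ large. Floer data: $\theta=\sum p_i\,dq^i$, $\omega_0=-d\theta=\sum dq^i\wedge dp_i$ on $T^*N$; $\omega_0(X_H,\cdot)=dH$; $J_h(X)=X^\flat$, $J_h(\alpha)=-\alpha^\sharp$ under the Levi-Civita splitting $T(T^*N)\cong TN\oplus T^*N$. Hamiltonian chords are $\gamma:[0,1]\to T^*N$ with $\dot\gamma=X_{H_h}(\gamma)$, $\gamma(0),\gamma(1)\in\nu^*T$; constant chords form a Morse-Bott copy of $T$. $CW(\nu^*T;H_h)=C^*(T)\oplus\bigoplus_x\mathbb Z\,x$ with $C^*(T)$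 a cochain complex of $T$ and $x$ running over non-constant chords, graded by $|x|$ = Morse index of the geodesic cord $\pi\circ x$ for the energy functional $\frac12\int|\dot c|_h^2$ on paths with endpoints on $T$. $C^*(T)$ is a subcomplex and $\widetilde{CW}=CW/C^*(T)$ is generated by the non-constant chords. The map $\widetilde{\mathfrak m}^k:\widetilde{CW}^{\otimes k}\to\widetilde{CW}[2-k]$ is $\widetilde{\mathfrak m}^k(x^1\otimes\dots\otimes x^k)=\sum_{x^0}|\mathcal M^{k+1}(x^0;x^1,\dots,x^k)|\,x^0$, the sum over non-constant chords $x^0$ with $|x^0|=\sum_j|x^j|+2-k$, where $|\mathcal M^{k+1}|$ is the signed count of the zero-dimensional moduli space (after a $C^\infty$-small perturbation of $J_h$ if needed) of maps $u:\Sigma\to T^*N$, $\Sigma$ a disc with $k+1$ boundary punctures $z^0,\dots,z^k$ of varying conformal structure (modulo $\tau$-translation if $k=1$), solving $(du-X_{H_h}\otimes\beta)^{(0,1)}_{\mathbf J}=0$. Here $\beta$ is a 1-form with $d\beta=0$, $d(\beta\circ j)=0$, $\beta|_{\partial\Sigma}=0$, equal to $w^jdt$ near $z^j$ with positive weights $w^0=w^1+\dots+w^k$; $\eta:\Sigma\to[1,\infty)$ converges to $w^j$ near $z^j$; $\mathbf J=\psi_\eta^*J_h$; $u(\zeta)\in\psi_{\eta(\zeta)}(\nu^*T)$ for $\zeta\in\partial\Sigma$; and $u$ is asymptotic at $z^j$ to $\psi_{w^j}\circ x^j$ (inputs $j\ge1$ at $\tau\to-\infty$, output $j=0$ at $\tau\to+\infty$),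 where $\psi_w$ is the fibrewise rescaling of $T^*N$ identifying chords of $H_h$ with those of $wH_h$. *)

theory Defs
  imports "HOL-Analysis.Analysis" "HOL-Library.Extended_Nat" "HOL-Library.Poly_Mapping"
begin

subsection \<open>Smooth maps\<close>

primrec dir_derivs ::
    "'a::euclidean_space list \<Rightarrow> ('a \<Rightarrow> 'b::euclidean_space) \<Rightarrow> 'a \<Rightarrow> 'b" where
  "dir_derivs [] f = f"
| "dir_derivs (v # vs) f = (\<lambda>x. frechet_derivative (dir_derivs vs f) (at x) v)"

text \<open>For open sets: all iterated directional derivatives exist and are differentiable.\<close>

definition smooth_on ::
    "'a::euclidean_space set \<Rightarrow> ('a \<Rightarrow> 'b::euclidean_space) \<Rightarrow> bool" where
  "smooth_on S f \<longleftrightarrow> (\<forall>vs. \<forall>x\<in>S. dir_derivs vs f differentiable (at x))"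

text \<open>For arbitrary sets: local smooth extendability (smoothness up to the boundary).\<close>

definition smooth_upto ::
    "'a::euclidean_space set \<Rightarrow> ('a \<Rightarrow> 'b::euclidean_space) \<Rightarrow> bool" where
  "smooth_upto S f \<longleftrightarrow>
    (\<forall>x\<in>S. \<exists>U g. open U \<and> x \<in> U \<and> smooth_on U g \<and> (\<forall>y\<in>U \<inter> S. f y = g y))"


subsection \<open>Closed oriented 3-manifolds and knots\<close>

definition closed_oriented_3manifold ::
    "'m::t2_space set \<Rightarrow> ('m set \<times> ('m \<Rightarrow> real^3)) set \<Rightarrow> bool" where
  "closed_oriented_3manifold M A \<longleftrightarrow>
    compact M \<and> connected M \<and> M = (\<Union>(U, \<phi>)\<in>A. U) \<and>
    (\<forall>(U, \<phi>)\<in>A. openin (top_of_set M) U \<and> open (\<phi> ` U) \<and>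
       homeomorphism U (\<phi> ` U) \<phi> (inv_into U \<phi>)) \<and>
    (\<forall>(U, \<phi>)\<in>A. \<forall>(V, \<psi>)\<in>A.
       smooth_on (\<phi> ` (U \<inter> V)) (\<psi> \<circ> inv_into U \<phi>) \<and>
       (\<forall>x\<in>\<phi> ` (U \<inter> V).
          det (matrix (frechet_derivative (\<psi> \<circ> inv_into U \<phi>) (at x))) > 0))"

definition smooth_knot ::
    "'m::t2_space set \<Rightarrow> ('m set \<times> ('m \<Rightarrow> real^3)) set \<Rightarrow> 'm set \<Rightarrow> bool" where
  "smooth_knot M A K \<longleftrightarrow>
    (\<exists>\<kappa> :: real \<Rightarrow> 'm. range \<kappa> = K \<and> K \<subseteq> M \<and> continuous_on UNIV \<kappa> \<and>
       (\<forall>t. \<kappa> (t + 1) = \<kappa> t) \<and> inj_on \<kappa> {0..<1} \<and>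
       (\<forall>(U, \<phi>)\<in>A. smooth_on (\<kappa> -` U) (\<phi> \<circ> \<kappa>) \<and>
          (\<forall>t\<in>\<kappa> -` U. vector_derivative (\<phi> \<circ> \<kappa>) (at t) \<noteq> 0)))"


subsection \<open>Hyperbolic space and hyperbolic structures\<close>

definition H3 :: "(real^3) set" where
  "H3 = {q. q $ 3 > 0}"

definition hyp :: "real^3 \<Rightarrow> real^3 \<Rightarrow> real^3 \<Rightarrow> real" where
  "hyp q v w = (v \<bullet> w) / (q $ 3)\<^sup>2"

definition hyp_isometry :: "(real^3 \<Rightarrow> real^3) \<Rightarrow> bool" where
  "hyp_isometry g \<longleftrightarrow> bij_betw g H3 H3 \<and> smooth_on H3 g \<and>
    (\<forall>q\<in>H3. \<forall>v w. hyp (g q) (frechet_derivative g (at q) v) (frechet_derivative g (at q) w)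
                    = hyp q v w)"

definition deck :: "(real^3 \<Rightarrow> 'm) \<Rightarrow> (real^3 \<Rightarrow> real^3) set" where
  "deck p = {g. hyp_isometry g \<and> (\<forall>q\<in>H3. p (g q) = p q)}"

text \<open>
  A complete hyperbolic metric \<open>h\<close> on \<open>N = M - K\<close> is given by its universal Riemannian
  covering \<open>p : H3 \<rightarrow> N\<close>: a smooth covering whose fibres are orbits of
  isometric deck transformations, so that the metric of \<open>H3\<close> descends to \<open>N\<close>.
  The knot is hyperbolic if \<open>N\<close> has such a metric of finite volume; the volume form
  is \<open>dx dy dz / z^3\<close>.
\<close>

definition hyperbolic_knot ::
    "'m::t2_space set \<Rightarrow> ('m set \<times> ('m \<Rightarrow> real^3)) set \<Rightarrow> 'm set \<Rightarrow> (real^3 \<Rightarrow> 'm) \<Rightarrow> bool" where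
  "hyperbolic_knot M A K p \<longleftrightarrow>
    smooth_knot M A K \<and>
    covering_space H3 p (M - K) \<and>
    (\<forall>(U, \<phi>)\<in>A. smooth_on (H3 \<inter> p -` U) (\<phi> \<circ> p) \<and>
       (\<forall>q\<in>H3 \<inter> p -` U. bij (frechet_derivative (\<phi> \<circ> p) (at q)))) \<and>
    (\<forall>q\<in>H3. \<forall>q'\<in>H3. p q = p q' \<longrightarrow> (\<exists>g\<in>deck p. g q = q')) \<and>
    (\<exists>F\<in>sets borel. F \<subseteq> H3 \<and> p ` F = M - K \<and>
       set_integrable lborel F (\<lambda>q. 1 / (q $ 3) ^ 3))"

text \<open>
  The covering is normalised so that the cusp is at infinity.  The height \<open>z0\<close> is large
  in the sense that the horoball \<open>z \<ge> z0\<close> meets its translate under a deck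
  transformation only if the latter belongs to a rank two lattice of horizontal translations.
  Then the image of the horosphere is an embedded torus, the quotient of a plane by the lattice.
\<close>

definition horo_torus :: "(real^3 \<Rightarrow> 'm) \<Rightarrow> 'm set \<Rightarrow> bool" where
  "horo_torus p T \<longleftrightarrow>
    (\<exists>z0>0. T = p ` {q. q $ 3 = z0} \<and>
      (\<exists>a b. a $ 3 = 0 \<and> b $ 3 = 0 \<and> a \<noteq> b \<and> independent {a, b} \<and>
         (\<forall>q\<in>H3. p (q + a) = p q \<and> p (q + b) = p q) \<and>
         (\<forall>g\<in>deck p. (\<exists>q. q $ 3 \<ge> z0 \<and> g q $ 3 \<ge> z0) \<longrightarrow>
            (\<exists>m n :: int. \<forall>q\<in>H3. g q = q + of_int m *\<^sub>R a + of_int n *\<^sub>R b))))"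

definition lift_set :: "(real^3 \<Rightarrow> 'm) \<Rightarrow> 'm set \<Rightarrow> (real^3) set" where
  "lift_set p T = {q \<in> H3. p q \<in> T}"


subsection \<open>The cotangent bundle\<close>

text \<open>
  \<open>(q, \<xi>)\<close> is the covector \<open>v \<mapsto> \<xi> \<bullet> v\<close> at \<open>q\<close>.  A point of \<open>T^*N\<close> is an orbit of
  points of \<open>T^*H3\<close> under the cotangent lifts of the deck transformations.
\<close>

type_synonym cot = "(real^3) \<times> (real^3)"
type_synonym path = "real \<Rightarrow> cot set"

definition cotH3 :: "cot set" where
  "cotH3 = H3 \<times> UNIV"

definition cot_lift :: "(real^3 \<Rightarrow> real^3) \<Rightarrow> cot \<Rightarrow> cot" where
  "cot_lift g = (\<lambda>(q, \<xi>). (g q, adjoint (inv (frechet_derivative g (at q))) \<xi>))"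

definition cot_class :: "(real^3 \<Rightarrow> 'm) \<Rightarrow> cot \<Rightarrow> cot set" where
  "cot_class p y = {cot_lift g y | g. g \<in> deck p}"

definition tangent_vectors :: "(real^3) set \<Rightarrow> real^3 \<Rightarrow> (real^3) set" where
  "tangent_vectors S q = {v. \<exists>c d. d > 0 \<and> smooth_on {-d<..<d} c \<and> c ` {-d<..<d} \<subseteq> S \<and>
     c 0 = q \<and> vector_derivative c (at (0::real)) = v}"

definition conormal :: "(real^3 \<Rightarrow> 'm) \<Rightarrow> 'm set \<Rightarrow> cot set set" where
  "conormal p T = {cot_class p (q, \<xi>) | q \<xi>. q \<in> lift_set p T \<and>
     (\<forall>v\<in>tangent_vectors (lift_set p T) q. \<xi> \<bullet> v = 0)}"

definition omega0 :: "cot \<Rightarrow> cot \<Rightarrow> real" where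
  "omega0 v w = fst v \<bullet> snd w - snd v \<bullet> fst w"

definition ham_vf :: "(cot \<Rightarrow> real) \<Rightarrow> cot \<Rightarrow> cot" where
  "ham_vf H y = (THE X. \<forall>Y. omega0 X Y = frechet_derivative H (at y) Y)"

definition flat :: "real^3 \<Rightarrow> real^3 \<Rightarrow> real^3" where
  "flat q v = (1 / (q $ 3)\<^sup>2) *\<^sub>R v"

definition sharp :: "real^3 \<Rightarrow> real^3 \<Rightarrow> real^3" where
  "sharp q \<alpha> = (q $ 3)\<^sup>2 *\<^sub>R \<alpha>"

definition H_kin :: "cot \<Rightarrow> real" where
  "H_kin = (\<lambda>(q, \<xi>). hyp q (sharp q \<xi>) (sharp q \<xi>) / 2)"

text \<open>
  Koszul formula for coordinate fields: \<open>christoffel q a b\<close> is the covariant derivative of the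
  constant field \<open>b\<close> in direction \<open>a\<close>.
\<close>

definition christoffel :: "real^3 \<Rightarrow> real^3 \<Rightarrow> real^3 \<Rightarrow> real^3" where
  "christoffel q a b = (THE G. \<forall>c. 2 * hyp q G c =
      frechet_derivative (\<lambda>r. hyp r b c) (at q) a
    + frechet_derivative (\<lambda>r. hyp r a c) (at q) b
    - frechet_derivative (\<lambda>r. hyp r a b) (at q) c)"

text \<open>
  Coordinates \<open>(X, \<alpha>)\<close> of the splitting into horizontal and vertical vectors at \<open>(q, \<xi>)\<close>:
  the vertical part of \<open>(a, b)\<close> is the covariant derivative
  \<open>e \<mapsto> b \<bullet> e - \<xi> \<bullet> christoffel q a e\<close> of the covector.
\<close>

definition conn_form :: "cot \<Rightarrow> real^3 \<Rightarrow> real^3" where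
  "conn_form y a = (\<chi> i. snd y \<bullet> christoffel (fst y) a (axis i 1))"

definition split_tangent :: "cot \<Rightarrow> cot \<Rightarrow> cot" where
  "split_tangent y v = (fst v, snd v - conn_form y (fst v))"

definition join_tangent :: "cot \<Rightarrow> cot \<Rightarrow> cot" where
  "join_tangent y w = (fst w, snd w + conn_form y (fst w))"

definition J_h :: "cot \<Rightarrow> cot \<Rightarrow> cot" where
  "J_h y v = (let (X, \<alpha>) = split_tangent y v in
     join_tangent y (- sharp (fst y) \<alpha>, flat (fst y) X))"

text \<open>
  Compatible almost complex structures on \<open>T^*N\<close>, as deck invariant ones on \<open>T^*H3\<close>.
\<close>

definition compatible_acs :: "(real^3 \<Rightarrow> 'm) \<Rightarrow> (cot \<Rightarrow> cot \<Rightarrow> cot) \<Rightarrow> bool" where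
  "compatible_acs p J \<longleftrightarrow>
    (\<forall>w. smooth_on cotH3 (\<lambda>y. J y w)) \<and>
    (\<forall>y\<in>cotH3. linear (J y) \<and>
       (\<forall>v. J y (J y v) = - v) \<and>
       (\<forall>v w. omega0 (J y v) (J y w) = omega0 v w) \<and>
       (\<forall>v. v \<noteq> 0 \<longrightarrow> omega0 v (J y v) > 0)) \<and>
    (\<forall>g\<in>deck p. \<forall>y\<in>cotH3. \<forall>v.
       J (cot_lift g y) (frechet_derivative (cot_lift g) (at y) v)
       = frechet_derivative (cot_lift g) (at y) (J y v))"

text \<open>The basic neighbourhoods of \<open>J_h\<close> in the compact-open \<open>C^\<infinity>\<close> topology.\<close>

definition J_h_nhd ::
    "(real^3 \<Rightarrow> 'm) \<Rightarrow> cot set \<Rightarrow> nat \<Rightarrow> real \<Rightarrow> (cot \<Rightarrow> cot \<Rightarrow> cot) set" where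
  "J_h_nhd p C n e = {J. compatible_acs p J \<and>
     (\<forall>y\<in>C. \<forall>vs w. length vs \<le> n \<and> (\<forall>v\<in>set vs. norm v \<le> 1) \<and> norm w \<le> 1 \<longrightarrow>
        norm (dir_derivs vs (\<lambda>x. J x w - J_h x w) y) < e)}"

text \<open>
  The rescaling \<open>\<psi>\<^sub>c\<close>: if \<open>(q, \<xi>)\<close> is a chord of \<open>H\<close> then \<open>(q, \<xi> / c)\<close> is a chord of
  \<open>c H\<close> over the same geodesic.  As a map of \<open>cot\<close> it is linear, hence equal to its
  differential; it commutes with cotangent lifts and so descends to \<open>T^*N\<close>.
\<close>

definition resc :: "real \<Rightarrow> cot \<Rightarrow> cot" where
  "resc c = (\<lambda>(q, \<xi>). (q, (1 / c) *\<^sub>R \<xi>))"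

definition pullback_acs :: "real \<Rightarrow> (cot \<Rightarrow> cot \<Rightarrow> cot) \<Rightarrow> cot \<Rightarrow> cot \<Rightarrow> cot" where
  "pullback_acs c J y v = resc (1 / c) (J (resc c y) (resc c v))"


subsection \<open>Chords and their Morse index\<close>

definition chord_lift :: "(real^3 \<Rightarrow> 'm) \<Rightarrow> path \<Rightarrow> (real \<Rightarrow> cot) \<Rightarrow> bool" where
  "chord_lift p x y \<longleftrightarrow>
    (\<forall>t\<in>{0..1}. y t \<in> cotH3 \<and> x t = cot_class p (y t) \<and>
       (y has_vector_derivative ham_vf H_kin (y t)) (at t within {0..1}))"

definition chords :: "(real^3 \<Rightarrow> 'm) \<Rightarrow> 'm set \<Rightarrow> path set" where
  "chords p T = {x \<in> extensional {0..1}.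
     (\<exists>y. chord_lift p x y) \<and> x 0 \<in> conormal p T \<and> x 1 \<in> conormal p T}"

definition nonconst_chords :: "(real^3 \<Rightarrow> 'm) \<Rightarrow> 'm set \<Rightarrow> path set" where
  "nonconst_chords p T = {x \<in> chords p T. \<not> (\<exists>a. \<forall>t\<in>{0..1}. x t = a)}"

definition energy :: "(real \<Rightarrow> real^3) \<Rightarrow> real" where
  "energy c = (1/2) * integral {0..1}
     (\<lambda>t. hyp (c t) (vector_derivative c (at t)) (vector_derivative c (at t)))"

text \<open>
  Variations of a path in \<open>N\<close> through paths with endpoints on \<open>T\<close>, lifted to \<open>H3\<close>; \<open>S\<close> is
  the preimage of \<open>T\<close>.
\<close>

definition variation ::
    "(real^3) set \<Rightarrow> (real \<Rightarrow> real^3) \<Rightarrow> (real \<Rightarrow> real \<Rightarrow> real^3) \<Rightarrow> bool" where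
  "variation S c C \<longleftrightarrow>
    (\<exists>W. open W \<and> {0} \<times> {0..1} \<subseteq> W \<and> smooth_on W (\<lambda>(s, t). C s t) \<and>
       (\<forall>(s, t)\<in>W. C s t \<in> H3) \<and>
       (\<forall>s. (s, 0) \<in> W \<longrightarrow> C s 0 \<in> S) \<and> (\<forall>s. (s, 1) \<in> W \<longrightarrow> C s 1 \<in> S)) \<and>
    (\<forall>t\<in>{0..1}. C 0 t = c t)"

text \<open>
  \<open>D\<close> is the value at \<open>V\<close> of the Hessian of the energy at \<open>c\<close>; for a critical point \<open>c\<close> it
  does not depend on the variation with variation field \<open>V\<close>.
\<close>

definition has_second_variation ::
    "(real^3) set \<Rightarrow> (real \<Rightarrow> real^3) \<Rightarrow> (real \<Rightarrow> real^3) \<Rightarrow> real \<Rightarrow> bool" where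
  "has_second_variation S c V D \<longleftrightarrow>
    (\<exists>C. variation S c C \<and>
       (\<forall>t\<in>{0..1}. vector_derivative (\<lambda>s. C s t) (at 0) = V t) \<and>
       D = deriv (deriv (\<lambda>s. energy (C s))) 0)"

text \<open>
  The maximal dimension of a space of variation fields on which the Hessian is negative
  definite; \<open>V 0, \<dots>, V (m - 1)\<close> is a basis of such a space (independence is automatic since
  the Hessian vanishes at 0).
\<close>

definition neg_def_family ::
    "(real^3) set \<Rightarrow> (real \<Rightarrow> real^3) \<Rightarrow> nat \<Rightarrow> (nat \<Rightarrow> real \<Rightarrow> real^3) \<Rightarrow> bool" where
  "neg_def_family S c m V \<longleftrightarrow>
    (\<forall>a :: nat \<Rightarrow> real. (\<exists>i<m. a i \<noteq> 0) \<longrightarrow>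
       (\<exists>D<0. has_second_variation S c (\<lambda>t. \<Sum>i<m. a i *\<^sub>R V i t) D))"

definition chord_index :: "(real^3 \<Rightarrow> 'm) \<Rightarrow> 'm set \<Rightarrow> path \<Rightarrow> enat" where
  "chord_index p T x = Sup {enat m | m.
     \<exists>y V. chord_lift p x y \<and> neg_def_family (lift_set p T) (fst \<circ> y) m V}"


subsection \<open>Punctured discs and Floer data\<close>

text \<open>
  The closed disc with boundary punctures \<open>z^0, \<dots>, z^k\<close> in counterclockwise order is the
  closed upper half plane with \<open>z^0 = \<infinity>\<close> and real punctures \<open>z^1 < \<dots> < z^k\<close>; the list
  entry \<open>zs ! j\<close> is \<open>z^(j+1)\<close>.
  Conformal isomorphisms are the maps \<open>\<zeta> \<mapsto> a \<zeta> + b\<close> with \<open>a > 0\<close>.  For \<open>k = 1\<close> the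
  isomorphisms fixing \<open>z^1\<close> are the translations in \<open>\<tau>\<close> of the strip.
\<close>

definition config :: "real list \<Rightarrow> bool" where
  "config zs \<longleftrightarrow> zs \<noteq> [] \<and> sorted_wrt (<) zs"

definition surface :: "real list \<Rightarrow> complex set" where
  "surface zs = {\<zeta>. Im \<zeta> \<ge> 0} - of_real ` set zs"

definition aff :: "real \<Rightarrow> real \<Rightarrow> complex \<Rightarrow> complex" where
  "aff a b \<zeta> = of_real a * \<zeta> + of_real b"

definition move :: "real \<Rightarrow> real \<Rightarrow> real list \<Rightarrow> real list" where
  "move a b = map (\<lambda>z. a * z + b)"

text \<open>The strip coordinate is \<open>\<tau> + i t\<close>; inputs are at \<open>\<tau> \<rightarrow> -\<infinity>\<close>, the output at \<open>\<tau> \<rightarrow> +\<infinity>\<close>.\<close>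

definition in_strip :: "complex set" where
  "in_strip = {\<zeta>. Re \<zeta> \<le> 0 \<and> 0 \<le> Im \<zeta> \<and> Im \<zeta> \<le> 1}"

definition out_strip :: "complex set" where
  "out_strip = {\<zeta>. Re \<zeta> \<ge> 0 \<and> 0 \<le> Im \<zeta> \<and> Im \<zeta> \<le> 1}"

definition at_in :: "complex filter" where
  "at_in = inf (filtercomap Re at_bot) (principal in_strip)"

definition at_out :: "complex filter" where
  "at_out = inf (filtercomap Re at_top) (principal out_strip)"

text \<open>
  \<open>form\<close> is \<open>\<beta>\<close> (base point, tangent vector) and \<open>scale\<close> is \<open>\<eta>\<close>.
\<close>

record floer_datum =
  weight :: "real list"
  form :: "complex \<Rightarrow> complex \<Rightarrow> real"
  scale :: "complex \<Rightarrow> real"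
  in_end :: "nat \<Rightarrow> complex \<Rightarrow> complex"
  out_end :: "complex \<Rightarrow> complex"

definition out_weight :: "floer_datum \<Rightarrow> real" where
  "out_weight d = sum_list (weight d)"

definition closed_form :: "complex set \<Rightarrow> (complex \<Rightarrow> complex \<Rightarrow> real) \<Rightarrow> bool" where
  "closed_form U b \<longleftrightarrow>
    (\<forall>\<zeta>\<in>U. frechet_derivative (\<lambda>x. b x \<i>) (at \<zeta>) 1 = frechet_derivative (\<lambda>x. b x 1) (at \<zeta>) \<i>)"

text \<open>
  A parametrised end of the surface: boundary edges go to the boundary, and \<open>\<beta>\<close> pulls back
  to \<open>w dt\<close>.
\<close>

definition strip_end ::
    "real list \<Rightarrow> (complex \<Rightarrow> complex \<Rightarrow> real) \<Rightarrow> complex set \<Rightarrow> real \<Rightarrow> (complex \<Rightarrow> complex) \<Rightarrow> bool"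
  where
  "strip_end zs b strip w \<epsilon> \<longleftrightarrow>
    \<epsilon> analytic_on strip \<and> inj_on \<epsilon> strip \<and> \<epsilon> ` strip \<subseteq> surface zs \<and>
    (\<forall>\<zeta>\<in>strip. Im \<zeta> = 0 \<or> Im \<zeta> = 1 \<longrightarrow> Im (\<epsilon> \<zeta>) = 0) \<and>
    (\<forall>\<zeta>\<in>strip. \<forall>v. b (\<epsilon> \<zeta>) (deriv \<epsilon> \<zeta> * v) = w * Im v)"

definition valid_floer_datum :: "real list \<Rightarrow> floer_datum \<Rightarrow> bool" where
  "valid_floer_datum zs d \<longleftrightarrow>
    length (weight d) = length zs \<and> (\<forall>w\<in>set (weight d). w > 0) \<and>
    (\<forall>\<zeta>\<in>surface zs. linear (form d \<zeta>)) \<and>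
    (\<forall>v. smooth_upto (surface zs) (\<lambda>\<zeta>. form d \<zeta> v)) \<and>
    closed_form {\<zeta>. Im \<zeta> > 0} (form d) \<and>
    closed_form {\<zeta>. Im \<zeta> > 0} (\<lambda>\<zeta> v. form d \<zeta> (\<i> * v)) \<and>
    (\<forall>\<zeta>\<in>surface zs. Im \<zeta> = 0 \<longrightarrow> form d \<zeta> 1 = 0) \<and>
    (\<forall>j<length zs. strip_end zs (form d) in_strip (weight d ! j) (in_end d j) \<and>
       filterlim (in_end d j) (nhds (of_real (zs ! j))) at_in) \<and>
    strip_end zs (form d) out_strip (out_weight d) (out_end d) \<and>
    filterlim (out_end d) at_infinity at_out \<and>
    smooth_upto (surface zs) (scale d) \<and> (\<forall>\<zeta>\<in>surface zs. scale d \<zeta> \<ge> 1) \<and>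
    (\<forall>j<length zs. (scale d \<longlongrightarrow> weight d ! j) (at (of_real (zs ! j)) within surface zs)) \<and>
    filterlim (scale d) (nhds (out_weight d)) (inf at_infinity (principal (surface zs)))"

text \<open>A choice of data for all punctured discs which depends only on the conformal structure.\<close>

definition floer_data :: "(real list \<Rightarrow> floer_datum) \<Rightarrow> bool" where
  "floer_data D \<longleftrightarrow>
    (\<forall>zs. config zs \<longrightarrow> valid_floer_datum zs (D zs) \<and>
      (\<forall>a b. a > 0 \<longrightarrow> weight (D (move a b zs)) = weight (D zs) \<and>
         (\<forall>\<zeta>\<in>surface zs.
            scale (D (move a b zs)) (aff a b \<zeta>) = scale (D zs) \<zeta> \<and>
            (\<forall>v. form (D (move a b zs)) (aff a b \<zeta>) (of_real a * v) = form (D zs) \<zeta> v))))"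


subsection \<open>Moduli spaces\<close>

text \<open>
  The equation \<open>(du - X \<otimes> \<beta>)^(0,1) = 0\<close> for a local lift \<open>v\<close> of \<open>u\<close>, where
  \<open>A^(0,1) = (A + J A j) / 2\<close>.
\<close>

definition floer_equation ::
    "(cot \<Rightarrow> cot \<Rightarrow> cot) \<Rightarrow> floer_datum \<Rightarrow> (complex \<Rightarrow> cot) \<Rightarrow> complex \<Rightarrow> bool" where
  "floer_equation J d v \<zeta> \<longleftrightarrow>
    (let A = (\<lambda>e. frechet_derivative v (at \<zeta>) e - form d \<zeta> e *\<^sub>R ham_vf H_kin (v \<zeta>))
     in \<forall>e. (1/2) *\<^sub>R (A e + pullback_acs (scale d \<zeta>) J (v \<zeta>) (A (\<i> * e))) = 0)"

text \<open>
  \<open>u \<circ> \<epsilon>\<close> converges to \<open>\<psi>\<^sub>w \<circ> x\<close> uniformly in \<open>t\<close> along the end.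
\<close>

definition asymptotic ::
    "(real^3 \<Rightarrow> 'm) \<Rightarrow> (complex \<Rightarrow> cot set) \<Rightarrow> (complex \<Rightarrow> complex) \<Rightarrow> complex filter \<Rightarrow>
     real \<Rightarrow> path \<Rightarrow> bool" where
  "asymptotic p u \<epsilon> F w x \<longleftrightarrow>
    (\<exists>y v. chord_lift p x y \<and>
       (\<forall>\<^sub>F \<zeta> in F. v \<zeta> \<in> cotH3 \<and> u (\<epsilon> \<zeta>) = cot_class p (v \<zeta>)) \<and>
       ((\<lambda>\<zeta>. dist (v \<zeta>) (resc w (y (Im \<zeta>)))) \<longlongrightarrow> 0) F)"

definition solution ::
    "(real^3 \<Rightarrow> 'm) \<Rightarrow> 'm set \<Rightarrow> (cot \<Rightarrow> cot \<Rightarrow> cot) \<Rightarrow> (real list \<Rightarrow> floer_datum) \<Rightarrow>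
     path \<Rightarrow> path list \<Rightarrow> real list \<Rightarrow> (complex \<Rightarrow> cot set) \<Rightarrow> bool" where
  "solution p T J D x0 xs zs u \<longleftrightarrow>
    config zs \<and> length zs = length xs \<and> u \<in> extensional (surface zs) \<and>
    (\<forall>\<zeta>\<in>surface zs. \<exists>U v. open U \<and> \<zeta> \<in> U \<and> smooth_on U v \<and> v ` U \<subseteq> cotH3 \<and>
       (\<forall>x\<in>U \<inter> surface zs. u x = cot_class p (v x) \<and> floer_equation J (D zs) v x)) \<and>
    (\<forall>\<zeta>\<in>surface zs. Im \<zeta> = 0 \<longrightarrow>
       u \<zeta> \<in> (\<lambda>Y. resc (scale (D zs) \<zeta>) ` Y) ` conormal p T) \<and>
    (\<forall>j<length xs. asymptotic p u (in_end (D zs) j) at_in (weight (D zs) ! j) (xs ! j)) \<and>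
    asymptotic p u (out_end (D zs)) at_out (out_weight (D zs)) x0"

type_synonym punctured_map = "real list \<times> (complex \<Rightarrow> cot set)"

definition conf_equiv :: "(punctured_map \<times> punctured_map) set" where
  "conf_equiv = {((zs, u), (zs', u')). \<exists>a b. a > 0 \<and> zs' = move a b zs \<and>
     (\<forall>\<zeta>\<in>surface zs. u' (aff a b \<zeta>) = u \<zeta>)}"

definition moduli ::
    "(real^3 \<Rightarrow> 'm) \<Rightarrow> 'm set \<Rightarrow> (cot \<Rightarrow> cot \<Rightarrow> cot) \<Rightarrow> (real list \<Rightarrow> floer_datum) \<Rightarrow>
     path \<Rightarrow> path list \<Rightarrow> punctured_map set set" where
  "moduli p T J D x0 xs =
    (let S = {(zs, u). solution p T J D x0 xs zs u} in S // (conf_equiv \<inter> S \<times> S))"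


subsection \<open>The reduced complex and its operations\<close>

text \<open>
  \<open>sg x0 xs\<close> assigns to the points of the moduli space their orientation signs.
  The counts and sums below are finite for regular \<open>J\<close>; otherwise the values are left
  unspecified instead of being set to 0.
\<close>

type_synonym signs = "path \<Rightarrow> path list \<Rightarrow> punctured_map set \<Rightarrow> int"

definition sign_choice :: "signs \<Rightarrow> bool" where
  "sign_choice sg \<longleftrightarrow> (\<forall>x0 xs c. sg x0 xs c = 1 \<or> sg x0 xs c = -1)"

definition signed_count ::
    "(real^3 \<Rightarrow> 'm) \<Rightarrow> 'm set \<Rightarrow> (cot \<Rightarrow> cot \<Rightarrow> cot) \<Rightarrow> (real list \<Rightarrow> floer_datum) \<Rightarrow> signs \<Rightarrow>
     path \<Rightarrow> path list \<Rightarrow> int" where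
  "signed_count p T J D sg x0 xs =
    (if finite (moduli p T J D x0 xs) then \<Sum>c\<in>moduli p T J D x0 xs. sg x0 xs c else undefined)"

definition reduced_CW :: "(real^3 \<Rightarrow> 'm) \<Rightarrow> 'm set \<Rightarrow> (path \<Rightarrow>\<^sub>0 int) set" where
  "reduced_CW p T = {f. Poly_Mapping.keys f \<subseteq> nonconst_chords p T}"

text \<open>
  Outputs satisfy \<open>|x0| = \<Sum> |xs| + 2 - k\<close>, written without subtraction.
\<close>

definition outputs ::
    "(real^3 \<Rightarrow> 'm) \<Rightarrow> 'm set \<Rightarrow> (cot \<Rightarrow> cot \<Rightarrow> cot) \<Rightarrow> (real list \<Rightarrow> floer_datum) \<Rightarrow> signs \<Rightarrow>
     path list \<Rightarrow> path set" where
  "outputs p T J D sg xs = {x0 \<in> nonconst_chords p T.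
     chord_index p T x0 + enat (length xs) = sum_list (map (chord_index p T) xs) + 2 \<and>
     signed_count p T J D sg x0 xs \<noteq> 0}"

definition m_gen ::
    "(real^3 \<Rightarrow> 'm) \<Rightarrow> 'm set \<Rightarrow> (cot \<Rightarrow> cot \<Rightarrow> cot) \<Rightarrow> (real list \<Rightarrow> floer_datum) \<Rightarrow> signs \<Rightarrow>
     path list \<Rightarrow> path \<Rightarrow>\<^sub>0 int" where
  "m_gen p T J D sg xs =
    (if finite (outputs p T J D sg xs)
     then \<Sum>x0\<in>outputs p T J D sg xs. frag_cmul (signed_count p T J D sg x0 xs) (frag_of x0)
     else undefined)"

text \<open>
  The multilinear extension; on lists of length \<open>k\<close> this is \<open>m^k\<close> on \<open>k\<close>-fold tensors.
\<close>

definition m_tilde ::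
    "(real^3 \<Rightarrow> 'm) \<Rightarrow> 'm set \<Rightarrow> (cot \<Rightarrow> cot \<Rightarrow> cot) \<Rightarrow> (real list \<Rightarrow> floer_datum) \<Rightarrow> signs \<Rightarrow>
     (path \<Rightarrow>\<^sub>0 int) list \<Rightarrow> path \<Rightarrow>\<^sub>0 int" where
  "m_tilde p T J D sg fs =
    (\<Sum>xs\<in>listset (map Poly_Mapping.keys fs).
       frag_cmul (\<Prod>j<length fs. Poly_Mapping.lookup (fs ! j) (xs ! j)) (m_gen p T J D sg xs))"

end

theory Submission
  imports Defs
begin

text \<open>
  Why the theorem holds. The output \<open>x0\<close> of an operation with inputs \<open>xs\<close>, where \<open>length xs = k\<close>,
  satisfies \<open>|x0| + k = \<Sum> |xs| + 2\<close>. If every chord has Morse index zero, this equation says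
  \<open>k = 2\<close>: for \<open>k \<noteq> 2\<close> there are no outputs and the operation vanishes. So everything rests
  on the fact that a geodesic cord of the horo-torus minimises the energy among nearby paths with
  endpoints on the torus (\<open>variation_minimal\<close>). Since the energy is twice differentiable along
  a variation, its second variation is then nonnegative (\<open>second_variation_nonneg\<close>), and no
  variation field makes the Hessian negative (\<open>chord_index_eq_0\<close>).

  Minimality is a statement about hyperbolic space. The preimage of the torus is a family of disjoint
  horospheres, the translates of \<open>z = z0\<close> under the deck group; near each of its points it is a
  single horosphere (\<open>lift_set_locally_horosphere\<close>), and none of it lies above the height \<open>z0\<close>
  (\<open>lift_set_height_le\<close>). A lifted non-constant cord is a common perpendicular of two of these
  horospheres, and nearby paths in the variation join the same two. Hence it suffices that the
  common perpendicular realises the distance between the two horospheres.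

  The distance is controlled by the height functions \<open>log_height g q = ln (g q $ 3)\<close>, which are
  Busemann functions: their gradients have hyperbolic length one, and the horospheres are their level
  sets. Along any path the change of such a function bounds the length from below
  (\<open>energy_lower_bound\<close>), while it is linear, with the full speed, along the geodesic whose initial
  covector is a multiple of the gradient: the multiple of the gradient is transported by the Hamiltonian
  flow (\<open>eikonal_characteristic\<close>). So, with \<open>f\<close> the height function of the first horosphere, the
  cord has energy \<open>L^2 / 2\<close>, where \<open>L\<close> is the drop of \<open>f\<close> along it, and it remains to see that
  \<open>f\<close> has its maximum on the second horosphere at the end of the cord. In coordinates which
  make the second horosphere a horizontal plane, this is \<open>eikonal_horosphere_max\<close>: vertical rays
  starting at two points of the plane become asymptotic, and \<open>f\<close> drops with unit speed along the ray
  that continues the cord and at most with unit speed along the other one.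
\<close>

section \<open>Second derivatives and local minima\<close>

text \<open>
  The mean value theorem in the direction \<open>w\<close> reduces the second difference to a first difference
  of \<open>n\<close>, which the derivative of \<open>n\<close> at the single point \<open>x\<close> controls.
\<close>

lemma second_difference_tendsto:
  fixes f :: "'a::real_inner \<Rightarrow> real"
  assumes "open S" "x \<in> S"
    and f: "\<And>y. y \<in> S \<Longrightarrow> (f has_derivative (\<lambda>v. n y \<bullet> v)) (at y)"
    and n: "(n has_derivative N) (at x)"
  shows "((\<lambda>h. (f (x + h *\<^sub>R v + h *\<^sub>R w) - f (x + h *\<^sub>R v) - f (x + h *\<^sub>R w) + f x) / h\<^sup>2)
           \<longlongrightarrow> N v \<bullet> w) (at_right 0)"
proof (rule tendstoI)
  fix e :: real assume "e > 0"
  define a where "a = norm v + norm w + 1"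
  have a: "a > 0" "norm v + norm w < a" unfolding a_def by (auto simp: add_nonneg_pos)
  \<comment> \<open>The arguments of \<open>n\<close> differ from \<open>x\<close> by at most \<open>h * a\<close>. Two errors \<open>\<epsilon> * (h * a)\<close>, paired with
    \<open>w\<close> and divided by \<open>h\<close>, amount to at most \<open>e / 2\<close>.\<close>
  define \<epsilon> where "\<epsilon> = e / (4 * a * a)"
  have \<epsilon>: "\<epsilon> > 0" using \<open>e > 0\<close> a by (simp add: \<epsilon>_def)
  obtain d1 where d1: "d1 > 0" "\<And>y. norm (y - x) < d1 \<Longrightarrow> norm (n y - n x - N (y - x)) \<le> \<epsilon> * norm (y - x)"
    using n \<epsilon> unfolding has_derivative_at_alt by blast
  obtain d2 where d2: "d2 > 0" "ball x d2 \<subseteq> S" using assms(1,2) open_contains_ball by blast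
  interpret N: bounded_linear N using n by (rule has_derivative_bounded_linear)
  define d where "d = min d1 d2"
  have "d > 0" using d1 d2 by (simp add: d_def)
  have "\<bar>(f (x + h *\<^sub>R v + h *\<^sub>R w) - f (x + h *\<^sub>R v) - f (x + h *\<^sub>R w) + f x) / h\<^sup>2 - N v \<bullet> w\<bar> < e"
    if h: "0 < h" "h < d / a" for h
  proof -
    have ha: "h * a < d" using h a by (simp add: field_simps)
    have nb: "norm (h *\<^sub>R v + \<tau> *\<^sub>R w) < d" "norm (\<tau> *\<^sub>R w) < d"
        "norm (h *\<^sub>R v + \<tau> *\<^sub>R w) \<le> h * a" "norm (\<tau> *\<^sub>R w) \<le> h * a" if "0 \<le> \<tau>" "\<tau> \<le> h" for \<tau>
    proof -
      have t: "\<tau> * norm w \<le> h * norm w" using that by (simp add: mult_right_mono)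
      have "norm (h *\<^sub>R v + \<tau> *\<^sub>R w) \<le> h * norm v + \<tau> * norm w"
        using norm_triangle_ineq[of "h *\<^sub>R v" "\<tau> *\<^sub>R w"] h that by simp
      also have "\<dots> \<le> h * (norm v + norm w)" using t by (simp add: distrib_left)
      also have "\<dots> \<le> h * a" using h a by (intro mult_left_mono) auto
      finally show 1: "norm (h *\<^sub>R v + \<tau> *\<^sub>R w) \<le> h * a" .
      have "norm (\<tau> *\<^sub>R w) \<le> h * norm w" using t that by simp
      also have "\<dots> \<le> h * a" using h a by (intro mult_left_mono) (auto simp: a_def)
      finally show 2: "norm (\<tau> *\<^sub>R w) \<le> h * a" .
      show "norm (h *\<^sub>R v + \<tau> *\<^sub>R w) < d" "norm (\<tau> *\<^sub>R w) < d" using 1 2 ha by auto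
    qed
    have inS: "x + h *\<^sub>R v + \<tau> *\<^sub>R w \<in> S" "x + \<tau> *\<^sub>R w \<in> S" if "0 \<le> \<tau>" "\<tau> \<le> h" for \<tau>
    proof -
      have "dist (x + (h *\<^sub>R v + \<tau> *\<^sub>R w)) x < d2" "dist (x + \<tau> *\<^sub>R w) x < d2"
        using nb(1,2)[OF that] unfolding d_def by (simp_all only: dist_norm add_diff_cancel_left' min_less_iff_conj)
      then show "x + h *\<^sub>R v + \<tau> *\<^sub>R w \<in> S" "x + \<tau> *\<^sub>R w \<in> S" using d2(2)
        by (auto simp: add.assoc subset_iff dist_commute)
    qed
    define \<phi> where "\<phi> \<tau> = f (x + h *\<^sub>R v + \<tau> *\<^sub>R w) - f (x + \<tau> *\<^sub>R w)" for \<tau>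
    have \<phi>: "(\<phi> has_real_derivative (n (x + h *\<^sub>R v + \<tau> *\<^sub>R w) - n (x + \<tau> *\<^sub>R w)) \<bullet> w) (at \<tau>)"
      if "0 \<le> \<tau>" "\<tau> \<le> h" for \<tau>
    proof -
      have l: "((\<lambda>\<tau>. z + \<tau> *\<^sub>R w) has_derivative (\<lambda>s. s *\<^sub>R w)) (at \<tau>)" for z
        by (auto intro!: derivative_eq_intros)
      have "((\<lambda>\<tau>. f (z + \<tau> *\<^sub>R w)) has_derivative (\<lambda>s. n (z + \<tau> *\<^sub>R w) \<bullet> (s *\<^sub>R w))) (at \<tau>)"
        if "z + \<tau> *\<^sub>R w \<in> S" for z
        using diff_chain_at[OF l f[OF that]] by (simp add: o_def)
      note D = has_derivative_diff[OF this this, OF inS[OF that]]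
      show ?thesis unfolding \<phi>_def has_field_derivative_def
        by (rule has_derivative_eq_rhs[OF D]) (simp add: fun_eq_iff inner_diff_left algebra_simps)
    qed
    obtain \<theta> where \<theta>: "0 < \<theta>" "\<theta> < h"
      "\<phi> h - \<phi> 0 = h * ((n (x + h *\<^sub>R v + \<theta> *\<^sub>R w) - n (x + \<theta> *\<^sub>R w)) \<bullet> w)"
      using MVT2[of 0 h \<phi> "\<lambda>\<tau>. (n (x + h *\<^sub>R v + \<tau> *\<^sub>R w) - n (x + \<tau> *\<^sub>R w)) \<bullet> w"] h(1) \<phi>
      by (metis diff_zero)
    define r where "r = n (x + h *\<^sub>R v + \<theta> *\<^sub>R w) - n (x + \<theta> *\<^sub>R w) - h *\<^sub>R N v"
    have "norm (n (x + (h *\<^sub>R v + \<theta> *\<^sub>R w)) - n x - N (h *\<^sub>R v + \<theta> *\<^sub>R w)) \<le> \<epsilon> * (h * a)"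
      using d1(2)[of "x + (h *\<^sub>R v + \<theta> *\<^sub>R w)"] nb[of \<theta>] \<theta> \<epsilon>
      by (simp add: d_def) (meson less_imp_le mult_left_mono order_trans)
    moreover have "norm (n (x + \<theta> *\<^sub>R w) - n x - N (\<theta> *\<^sub>R w)) \<le> \<epsilon> * (h * a)"
      using d1(2)[of "x + \<theta> *\<^sub>R w"] nb[of \<theta>] \<theta> \<epsilon>
      by (simp add: d_def) (smt (verit) mult_left_mono)
    moreover have "r = (n (x + (h *\<^sub>R v + \<theta> *\<^sub>R w)) - n x - N (h *\<^sub>R v + \<theta> *\<^sub>R w))
        - (n (x + \<theta> *\<^sub>R w) - n x - N (\<theta> *\<^sub>R w))"
      by (simp add: r_def N.add N.scaleR add.assoc)
    ultimately have "norm r \<le> \<epsilon> * (h * a) + \<epsilon> * (h * a)"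
      by (simp only:) (rule order_trans[OF norm_triangle_ineq4 add_mono])
    then have r: "norm r \<le> 2 * \<epsilon> * (h * a)" by (simp add: mult.commute mult.left_commute)
    have "\<phi> h - \<phi> 0 = h\<^sup>2 * (N v \<bullet> w) + h * (r \<bullet> w)"
      unfolding \<theta>(3) r_def by (simp add: inner_diff_left power2_eq_square algebra_simps)
    then have eq: "(f (x + h *\<^sub>R v + h *\<^sub>R w) - f (x + h *\<^sub>R v) - f (x + h *\<^sub>R w) + f x) / h\<^sup>2 - N v \<bullet> w
        = (r \<bullet> w) / h"
      using h by (simp add: \<phi>_def field_simps power2_eq_square)
    have "\<bar>r \<bullet> w\<bar> \<le> norm r * norm w" by (rule Cauchy_Schwarz_ineq2)
    also have "\<dots> \<le> (2 * \<epsilon> * (h * a)) * a"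
      using r a \<epsilon> h by (intro mult_mono) (auto simp: a_def)
    also have "\<dots> = h * (e / 2)" using a by (simp add: \<epsilon>_def)
    finally have "\<bar>r \<bullet> w\<bar> / h \<le> e / 2" using h by (simp add: field_simps)
    then have "\<bar>r \<bullet> w\<bar> / h < e" using \<open>e > 0\<close> by linarith
    then show ?thesis unfolding eq using h by (simp add: abs_divide)
  qed
  moreover have "d / a > 0" using \<open>d > 0\<close> a by simp
  ultimately show "\<forall>\<^sub>F h in at_right 0. dist ((f (x + h *\<^sub>R v + h *\<^sub>R w) - f (x + h *\<^sub>R v) - f (x + h *\<^sub>R w) + f x) / h\<^sup>2) (N v \<bullet> w) < e"
    unfolding eventually_at_right_field dist_real_def by blast
qed

text \<open>
  The second difference quotient is symmetric in \<open>v\<close> and \<open>w\<close>, hence so is its limit.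
\<close>

lemma hessian_symmetric:
  fixes f :: "'a::real_inner \<Rightarrow> real"
  assumes "open S" "x \<in> S"
    and "\<And>y. y \<in> S \<Longrightarrow> (f has_derivative (\<lambda>v. n y \<bullet> v)) (at y)"
    and "(n has_derivative N) (at x)"
  shows "N v \<bullet> w = N w \<bullet> v"
proof -
  have "((\<lambda>h. (f (x + h *\<^sub>R v + h *\<^sub>R w) - f (x + h *\<^sub>R v) - f (x + h *\<^sub>R w) + f x) / h\<^sup>2)
           \<longlongrightarrow> N w \<bullet> v) (at_right 0)"
    using second_difference_tendsto[OF assms, of w v] by (simp add: algebra_simps)
  with second_difference_tendsto[OF assms, of v w] show ?thesis
    by (rule tendsto_unique[OF trivial_limit_at_right_real])
qed

text \<open>
  The function \<open>W t * exp (- K * t)\<close> is nonincreasing and starts at zero.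
\<close>

lemma gronwall_zero:
  fixes W :: "real \<Rightarrow> real"
  assumes W: "\<And>t. t \<in> {0..b} \<Longrightarrow> (W has_real_derivative W' t) (at t within {0..b})"
    and le: "\<And>t. t \<in> {0..b} \<Longrightarrow> W' t \<le> K * W t"
    and nn: "\<And>t. t \<in> {0..b} \<Longrightarrow> W t \<ge> 0" and "W 0 = 0" and t: "t \<in> {0..b}"
  shows "W t = 0"
proof (cases "t = 0")
  case False
  define U where "U s = W s * exp (- K * s)" for s
  have U: "(U has_real_derivative (W' s - K * W s) * exp (- K * s)) (at s within {0..b})"
    if "s \<in> {0..b}" for s
    unfolding U_def by (rule derivative_eq_intros W that refl)+ (simp add: algebra_simps)
  have "U t \<le> U 0"
  proof (rule DERIV_nonpos_imp_decreasing_open[of 0 t U])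
    show "0 \<le> t" using t by auto
    show "continuous_on {0..t} U"
      by (rule continuous_on_subset[OF DERIV_continuous_on[OF U]]) (use t in auto)
    fix s assume s: "0 < s" "s < t"
    have "at s within {0..b} = at s" using s t by (intro at_within_interior) auto
    then have "(U has_real_derivative (W' s - K * W s) * exp (- K * s)) (at s)"
      using U[of s] s t by auto
    moreover have "(W' s - K * W s) * exp (- K * s) \<le> 0"
      using le[of s] s t by (simp add: mult_le_0_iff)
    ultimately show "\<exists>y. (U has_real_derivative y) (at s) \<and> y \<le> 0" by blast
  qed
  then have "W t * exp (- K * t) \<le> 0" using \<open>W 0 = 0\<close> by (simp add: U_def)
  then have "W t \<le> 0" by (simp add: mult_le_0_iff)
  then show ?thesis using nn[OF t] by simp
qed (use assms in simp)

text \<open>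
  If \<open>D\<close> were negative, \<open>E'\<close> would be negative just to the right of its zero at the origin, and
  \<open>E\<close> would decrease there. The iterated \<open>deriv\<close> is included because it is the form in which
  the second variation is given.
\<close>

lemma local_min_second_derivative:
  fixes E :: "real \<Rightarrow> real"
  assumes "d > 0" and E: "\<And>s. \<bar>s\<bar> < d \<Longrightarrow> (E has_real_derivative E' s) (at s)"
    and E': "(E' has_real_derivative D) (at 0)" and min: "\<And>s. \<bar>s\<bar> < d \<Longrightarrow> E 0 \<le> E s"
  shows "deriv (deriv E) 0 = D" "D \<ge> 0"
proof -
  have "deriv E s = E' s" if "\<bar>s\<bar> < d" for s using E[OF that] by (rule DERIV_imp_deriv)
  then have "(deriv E has_real_derivative D) (at 0)"
    using \<open>d > 0\<close>
    by (intro has_field_derivative_transform_within_open[OF E' open_ball[of 0 d], of "deriv E"]) (auto simp: dist_real_def)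
  then show "deriv (deriv E) 0 = D" by (rule DERIV_imp_deriv)
  have E0: "E' 0 = 0"
    by (rule DERIV_local_min[OF E[of 0] \<open>d > 0\<close>]) (use min \<open>d > 0\<close> in auto)
  show "D \<ge> 0"
  proof (rule ccontr)
    assume "\<not> D \<ge> 0"
    then obtain r where r: "r > 0" "\<And>h. 0 < h \<Longrightarrow> h < r \<Longrightarrow> E' h < E' 0"
      using DERIV_neg_dec_right[OF E'] by auto
    define s where "s = min r d / 2"
    have s: "0 < s" "s < r" "s < d" using r \<open>d > 0\<close> by (auto simp: s_def)
    obtain z where z: "0 < z" "z < s" "E s - E 0 = (s - 0) * E' z"
      using MVT2[of 0 s E E'] E s by auto
    have "E' z < 0" using r(2)[of z] z s E0 by auto
    then have "E s < E 0" using z s by (smt (verit) mult_pos_neg)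
    then show False using min[of s] s by auto
  qed
qed

section \<open>Upper half space and smooth maps\<close>

lemma in_H3 [simp]: "q \<in> H3 \<longleftrightarrow> 0 < q $ 3"
  by (simp add: H3_def)

lemma open_H3: "open H3"
  unfolding H3_def by (intro open_Collect_less continuous_intros)

lemma convex_H3: "convex H3"
proof -
  have "H3 = {q. axis 3 1 \<bullet> q > 0}" by (auto simp: H3_def inner_axis')
  then show ?thesis using convex_halfspace_gt[of 0 "axis 3 1 :: real^3"] by (simp only:)
qed

lemma connected_H3: "connected H3"
  by (simp add: convex_connected convex_H3)

lemma smooth_on_has_derivative:
  assumes "smooth_on S f" "x \<in> S"
  shows "(f has_derivative frechet_derivative f (at x)) (at x)"
  using assms unfolding smooth_on_def by (metis dir_derivs.simps(1) frechet_derivative_works)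

lemma smooth_on_deriv:
  assumes "smooth_on S f"
  shows "smooth_on S (\<lambda>x. frechet_derivative f (at x) v)"
proof -
  have "dir_derivs vs (\<lambda>x. frechet_derivative f (at x) v) = dir_derivs (vs @ [v]) f" for vs
    by (induction vs) auto
  then show ?thesis using assms unfolding smooth_on_def by auto
qed

lemma smooth_on_imp_continuous_on: "smooth_on S f \<Longrightarrow> continuous_on S f"
  by (meson continuous_at_imp_continuous_on has_derivative_continuous smooth_on_has_derivative)

lemma has_vector_derivative_compose:
  assumes "(g has_derivative g') (at (c t))" "(c has_vector_derivative v) (at t within S)"
  shows "((\<lambda>t. g (c t)) has_vector_derivative g' v) (at t within S)"
proof -
  have "((\<lambda>t. g (c t)) has_derivative (\<lambda>s. g' (s *\<^sub>R v))) (at t within S)"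
    using has_derivative_compose[OF assms(2)[unfolded has_vector_derivative_def] assms(1)] .
  moreover have "g' (s *\<^sub>R v) = s *\<^sub>R g' v" for s
    using has_derivative_linear[OF assms(1)] by (rule linear_scale)
  ultimately show ?thesis by (simp add: has_vector_derivative_def)
qed

text \<open>
  Every iterated derivative of the curve is a multiple of an iterated derivative of \<open>f\<close> in the constant direction
  \<open>v\<close>. This provides tangent vectors of the preimage of the torus.
\<close>

lemma smooth_on_compose_line:
  assumes f: "smooth_on S f" and S: "open S"
  shows "smooth_on {s::real. x + s *\<^sub>R v \<in> S} (\<lambda>s. f (x + s *\<^sub>R v))"
proof -
  define l where "l = (\<lambda>s::real. x + s *\<^sub>R v)"
  have oI: "open {s. l s \<in> S}"
  proof -
    have "continuous_on UNIV l" unfolding l_def by (intro continuous_intros)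
    then show ?thesis using open_vimage[OF S, of l] by (simp add: vimage_def)
  qed
  have l: "(l has_derivative (\<lambda>r. r *\<^sub>R v)) (at s)" for s
    unfolding l_def by (auto intro!: derivative_eq_intros)
  have D: "((\<lambda>s. c *\<^sub>R dir_derivs ws f (l s)) has_derivative
      (\<lambda>r. (r * c) *\<^sub>R dir_derivs (v # ws) f (l s))) (at s)" if "l s \<in> S" for s c ws
  proof -
    have d: "(dir_derivs ws f has_derivative frechet_derivative (dir_derivs ws f) (at (l s))) (at (l s))"
      using f that unfolding smooth_on_def by (metis frechet_derivative_works)
    show ?thesis
      using has_derivative_scaleR_right[OF has_derivative_compose[OF l d], of c]
        linear_scale[OF has_derivative_linear[OF d]] by (simp add: mult.commute)
  qed
  have E: "dir_derivs vs (\<lambda>s. f (l s)) s = prod_list vs *\<^sub>R dir_derivs (map (\<lambda>_. v) vs) f (l s)"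
    if "l s \<in> S" for vs s using that
  proof (induction vs arbitrary: s)
    case (Cons r vs)
    have "(dir_derivs vs (\<lambda>s. f (l s)) has_derivative
       (\<lambda>r. (r * prod_list vs) *\<^sub>R dir_derivs (v # map (\<lambda>_. v) vs) f (l s))) (at s)"
      by (rule has_derivative_transform_within_open[OF D[OF Cons.prems] oI]) (use Cons in auto)
    from fun_cong[OF frechet_derivative_at[OF this], of r] show ?case by simp
  qed simp
  have "smooth_on {s. l s \<in> S} (\<lambda>s. f (l s))" unfolding smooth_on_def
  proof (intro allI ballI)
    fix vs :: "real list" and s assume s: "s \<in> {s. l s \<in> S}"
    have "(dir_derivs vs (\<lambda>s. f (l s)) has_derivative
       (\<lambda>r. (r * prod_list vs) *\<^sub>R dir_derivs (v # map (\<lambda>_. v) vs) f (l s))) (at s)"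
      by (rule has_derivative_transform_within_open[OF D oI s]) (use s E in auto)
    then show "dir_derivs vs (\<lambda>s. f (l s)) differentiable (at s)" by (rule differentiableI)
  qed
  then show ?thesis by (simp add: l_def)
qed

lemma smooth_on_subset: "smooth_on S f \<Longrightarrow> T \<subseteq> S \<Longrightarrow> smooth_on T f"
  unfolding smooth_on_def by blast

section \<open>Height functions and the eikonal equation\<close>

text \<open>
  \<open>n\<close> is the Euclidean gradient of \<open>f\<close> and \<open>N x\<close> is the derivative of \<open>n\<close> at \<open>x\<close>. The covector
  \<open>n x\<close> has squared hyperbolic length \<open>(x $ 3)^2 * (n x \<bullet> n x)\<close>, so the third condition is the eikonal
  equation \<open>|df| = 1\<close>.
\<close>

definition eikonal :: "(real^3 \<Rightarrow> real) \<Rightarrow> (real^3 \<Rightarrow> real^3) \<Rightarrow> (real^3 \<Rightarrow> real^3 \<Rightarrow> real^3) \<Rightarrow> bool" where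
  "eikonal f n N \<longleftrightarrow>
    (\<forall>x\<in>H3. (f has_derivative (\<lambda>v. n x \<bullet> v)) (at x) \<and> (n has_derivative N x) (at x) \<and>
       (x $ 3)\<^sup>2 * (n x \<bullet> n x) = 1) \<and>
    (\<forall>v. continuous_on H3 (\<lambda>x. N x v))"

text \<open>
  For an isometry \<open>g\<close> this is a Busemann function: a level set of \<open>log_height g\<close> is a horosphere,
  the preimage under \<open>g\<close> of a horizontal plane.
\<close>

definition log_height :: "(real^3 \<Rightarrow> real^3) \<Rightarrow> real^3 \<Rightarrow> real" where
  "log_height g q = ln (g q $ 3)"

definition grad_log_height :: "(real^3 \<Rightarrow> real^3) \<Rightarrow> real^3 \<Rightarrow> real^3" where
  "grad_log_height g q = (\<chi> i. frechet_derivative g (at q) (axis i 1) $ 3 / g q $ 3)"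

lemma isometry_in_H3: "hyp_isometry g \<Longrightarrow> q \<in> H3 \<Longrightarrow> g q \<in> H3"
  unfolding hyp_isometry_def bij_betw_def by blast

lemma isometry_has_derivative:
  "hyp_isometry g \<Longrightarrow> q \<in> H3 \<Longrightarrow> (g has_derivative frechet_derivative g (at q)) (at q)"
  unfolding hyp_isometry_def using smooth_on_has_derivative by blast

lemma isometry_inner:
  assumes "hyp_isometry g" "q \<in> H3"
  shows "frechet_derivative g (at q) v \<bullet> frechet_derivative g (at q) w = (g q $ 3 / q $ 3)\<^sup>2 * (v \<bullet> w)"
proof -
  have "hyp (g q) (frechet_derivative g (at q) v) (frechet_derivative g (at q) w) = hyp q v w"
    using assms unfolding hyp_isometry_def by blast
  moreover have "g q $ 3 > 0" using isometry_in_H3[OF assms] by simp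
  ultimately show ?thesis using assms(2) by (simp add: hyp_def field_simps power_divide)
qed

lemma isometry_deriv_bij:
  assumes "hyp_isometry g" "q \<in> H3"
  shows "bij (frechet_derivative g (at q))"
proof -
  have lin: "linear (frechet_derivative g (at q))"
    using isometry_has_derivative[OF assms] by (rule has_derivative_linear)
  have "g q $ 3 > 0" using isometry_in_H3[OF assms] by simp
  have "v = 0" if "frechet_derivative g (at q) v = 0" for v
    using isometry_inner[OF assms, of v v] that \<open>g q $ 3 > 0\<close> assms(2) by auto
  then have "inj (frechet_derivative g (at q))" using linear_injective_0[OF lin] by blast
  then show ?thesis using linear_injective_imp_surjective[OF lin] by (simp add: bij_def)
qed

lemma grad_log_height_inner:
  assumes "hyp_isometry g" "q \<in> H3"
  shows "grad_log_height g q \<bullet> v = frechet_derivative g (at q) v $ 3 / g q $ 3"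
proof -
  define L where "L = frechet_derivative g (at q)"
  interpret L: linear L
    unfolding L_def using isometry_has_derivative[OF assms] by (rule has_derivative_linear)
  have "L v = L (\<Sum>i\<in>UNIV. (v $ i) *\<^sub>R axis i 1)"
    by (simp add: basis_expansion flip: scalar_mult_eq_scaleR)
  also have "\<dots> = (\<Sum>i\<in>UNIV. (v $ i) *\<^sub>R L (axis i 1))" by (simp add: L.sum L.scale)
  finally have "L v $ 3 = (\<Sum>i\<in>UNIV. v $ i * L (axis i 1) $ 3)" by simp
  then show ?thesis
    by (simp add: grad_log_height_def inner_vec_def L_def[symmetric] sum_divide_distrib mult.commute)
qed

text \<open>
  The derivative of \<open>g\<close> is conformal with factor \<open>g x $ 3 / x $ 3\<close>. If it maps \<open>u\<close> to the vertical
  unit vector, then the gradient is a multiple of \<open>u\<close>, and conformality gives the length of \<open>u\<close>.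
\<close>

lemma eikonal_log_height:
  assumes g: "hyp_isometry g"
  shows "\<exists>N. eikonal (log_height g) (grad_log_height g) N"
proof -
  define D where "D = (\<lambda>x. frechet_derivative g (at x))"
  define D2 where "D2 = (\<lambda>i x. frechet_derivative (\<lambda>x. D x (axis i 1)) (at x))"
  have sm: "smooth_on H3 g" using g by (simp add: hyp_isometry_def)
  have smD: "smooth_on H3 (\<lambda>x. D x v)" for v unfolding D_def by (rule smooth_on_deriv[OF sm])
  have smD2: "smooth_on H3 (\<lambda>x. D2 i x v)" for i v unfolding D2_def by (rule smooth_on_deriv[OF smD])
  have pos: "g x $ 3 > 0" if "x \<in> H3" for x using isometry_in_H3[OF g that] by simp
  define N where "N = (\<lambda>x v. \<Sum>i\<in>UNIV. ((D2 i x v $ 3 * g x $ 3 - D x (axis i 1) $ 3 * D x v $ 3) / (g x $ 3)\<^sup>2) *\<^sub>R axis i (1::real) :: real^3)"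
  have n: "grad_log_height g = (\<lambda>x. \<Sum>i\<in>UNIV. (D x (axis i 1) $ 3 / g x $ 3) *\<^sub>R axis i 1)"
    by (simp add: grad_log_height_def D_def fun_eq_iff vec_eq_iff axis_def if_distrib cong: if_cong)
  have "eikonal (log_height g) (grad_log_height g) N"
    unfolding eikonal_def
  proof (intro conjI ballI allI)
    fix x assume x: "x \<in> H3"
    have Dx: "frechet_derivative g (at x) = D x" by (simp add: D_def)
    have Dg: "(g has_derivative D x) (at x)" unfolding D_def by (rule isometry_has_derivative[OF g x])
    have c3: "((\<lambda>x. F x $ 3) has_derivative (\<lambda>v. F' v $ 3)) (at x)"
      if "(F has_derivative F') (at x)" for F F' :: "real^3 \<Rightarrow> real^3"
      using bounded_linear.has_derivative[OF bounded_linear_vec_nth that] .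
    have "((\<lambda>q. ln (g q $ 3)) has_derivative (\<lambda>v. D x v $ 3 / g x $ 3)) (at x)"
      using has_derivative_ln[OF pos[OF x] c3[OF Dg]] by (simp add: field_simps)
    then show "(log_height g has_derivative (\<lambda>v. grad_log_height g x \<bullet> v)) (at x)"
      by (simp add: log_height_def[abs_def] grad_log_height_inner[OF g x] D_def)
    have "((\<lambda>x. D x (axis i 1)) has_derivative D2 i x) (at x)" for i
      unfolding D2_def by (rule smooth_on_has_derivative[OF smD x])
    note D2 = c3[OF this]
    show "(grad_log_height g has_derivative N x) (at x)"
      unfolding n N_def
      by (rule derivative_eq_intros D2 c3[OF Dg] refl)+
         (use pos[OF x] in \<open>auto simp: fun_eq_iff power2_eq_square field_simps\<close>)
    obtain u where u: "D x u = axis 3 1"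
      using isometry_deriv_bij[OF g x] unfolding D_def bij_def by (metis surjD)
    have x0: "x $ 3 > 0" using x by simp
    have "grad_log_height g x \<bullet> v = (g x $ 3 / (x $ 3)\<^sup>2) *\<^sub>R u \<bullet> v" for v
    proof -
      have "D x v $ 3 = D x u \<bullet> D x v" by (simp add: u inner_axis')
      also have "\<dots> = (g x $ 3 / x $ 3)\<^sup>2 * (u \<bullet> v)" unfolding D_def by (rule isometry_inner[OF g x])
      finally show ?thesis using pos[OF x] x0
        by (simp add: grad_log_height_inner[OF g x] Dx power_divide power2_eq_square field_simps)
    qed
    then have gr: "grad_log_height g x = (g x $ 3 / (x $ 3)\<^sup>2) *\<^sub>R u" using vector_eq_rdot by blast
    have "(1::real) = D x u \<bullet> D x u" by (simp add: u inner_axis')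
    also have "\<dots> = (g x $ 3 / x $ 3)\<^sup>2 * (u \<bullet> u)" unfolding D_def by (rule isometry_inner[OF g x])
    also have "(g x $ 3 / x $ 3)\<^sup>2 = (x $ 3)\<^sup>2 * (g x $ 3 / (x $ 3)\<^sup>2)\<^sup>2"
      using x0 by (simp add: power2_eq_square)
    finally have "(x $ 3)\<^sup>2 * (g x $ 3 / (x $ 3)\<^sup>2)\<^sup>2 * (u \<bullet> u) = 1" by (rule sym)
    then show "(x $ 3)\<^sup>2 * (grad_log_height g x \<bullet> grad_log_height g x) = 1"
      by (simp only: gr inner_scaleR_left inner_scaleR_right power2_eq_square mult.assoc)
  next
    fix v
    have c: "continuous_on H3 g" "continuous_on H3 (\<lambda>x. D x v)" "continuous_on H3 (\<lambda>x. D2 i x v)" for i v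
      using sm smD smD2 by (auto intro: smooth_on_imp_continuous_on)
    have "\<forall>x\<in>H3. (g x $ 3)\<^sup>2 \<noteq> 0" using pos by fastforce
    then show "continuous_on H3 (\<lambda>x. N x v)" unfolding N_def
      by (intro continuous_intros c) auto
  qed
  then show ?thesis by blast
qed

lemma isometry_compose_derivative:
  assumes "hyp_isometry g" "hyp_isometry h" "\<And>q. q \<in> H3 \<Longrightarrow> k q = g (h q)" "q \<in> H3"
  shows "frechet_derivative k (at q) v = frechet_derivative g (at (h q)) (frechet_derivative h (at q) v)"
proof -
  have "((\<lambda>q. g (h q)) has_derivative (\<lambda>v. frechet_derivative g (at (h q)) (frechet_derivative h (at q) v))) (at q)"
    by (rule has_derivative_compose[OF isometry_has_derivative isometry_has_derivative])
       (use assms isometry_in_H3 in auto)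
  then have "(k has_derivative (\<lambda>v. frechet_derivative g (at (h q)) (frechet_derivative h (at q) v))) (at q)"
    by (rule has_derivative_transform_within_open[OF _ open_H3 assms(4)]) (use assms(3) in simp)
  from fun_cong[OF frechet_derivative_at[OF this], of v] show ?thesis by simp
qed

text \<open>
  The image under \<open>g\<close> of the horizontal plane through \<open>q0\<close> is a level set of \<open>log_height k\<close>, where
  \<open>k\<close> inverts \<open>g\<close>. This turns the conormal boundary condition into an initial condition on
  the gradient of a height function.
\<close>

lemma covector_orthogonal_to_horosphere:
  assumes g: "hyp_isometry g" and k: "hyp_isometry k" and kg: "\<And>q. q \<in> H3 \<Longrightarrow> k (g q) = q"
    and q0: "q0 \<in> H3" and orth: "\<And>v. v $ 3 = 0 \<Longrightarrow> \<xi> \<bullet> frechet_derivative g (at q0) v = 0"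
  shows "\<exists>\<kappa>. \<xi> = \<kappa> *\<^sub>R grad_log_height k (g q0)"
proof -
  define G where "G = frechet_derivative g (at q0)"
  define \<kappa> where "\<kappa> = q0 $ 3 * (\<xi> \<bullet> G (axis 3 1))"
  interpret G: linear G unfolding G_def
    by (rule has_derivative_linear[OF isometry_has_derivative[OF g q0]])
  have "\<xi> \<bullet> u = (\<kappa> *\<^sub>R grad_log_height k (g q0)) \<bullet> u" for u
  proof -
    obtain v where u: "u = G v"
      using isometry_deriv_bij[OF g q0] unfolding G_def bij_def by (metis surjD)
    have "frechet_derivative k (at (g q0)) (G v) = frechet_derivative (\<lambda>q. q) (at q0) v"
      unfolding G_def by (rule isometry_compose_derivative[OF k g _ q0, symmetric]) (simp add: kg)
    also have "frechet_derivative (\<lambda>q. q) (at q0) v = v"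
      using fun_cong[OF frechet_derivative_at[OF has_derivative_ident], of q0 v] by simp
    finally have "grad_log_height k (g q0) \<bullet> u = v $ 3 / q0 $ 3"
      using grad_log_height_inner[OF k isometry_in_H3[OF g q0], of u] kg[OF q0] by (simp add: u)
    moreover have "\<xi> \<bullet> u = v $ 3 * (\<xi> \<bullet> G (axis 3 1))"
    proof -
      have "\<xi> \<bullet> G (v - (v $ 3) *\<^sub>R axis 3 1) = 0" unfolding G_def by (rule orth) simp
      then show ?thesis by (simp add: u G.diff G.scale inner_diff_right)
    qed
    ultimately show ?thesis using q0 by (simp add: \<kappa>_def)
  qed
  then have "\<xi> = \<kappa> *\<^sub>R grad_log_height k (g q0)" using vector_eq_rdot by blast
  then show ?thesis ..
qed

section \<open>The geodesic flow along gradients\<close>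

lemma ham_vf_H_kin:
  assumes "q \<in> H3"
  shows "ham_vf H_kin (q, \<xi>) = ((q $ 3)\<^sup>2 *\<^sub>R \<xi>, - (q $ 3 * (\<xi> \<bullet> \<xi>)) *\<^sub>R axis 3 1)"
proof -
  define dH where "dH = (\<lambda>Y::cot. q $ 3 * (fst Y $ 3) * (\<xi> \<bullet> \<xi>) + (q $ 3)\<^sup>2 * (\<xi> \<bullet> snd Y))"
  have "((\<lambda>y::cot. (fst y $ 3)\<^sup>2 * (snd y \<bullet> snd y) / 2) has_derivative dH) (at (q, \<xi>))"
    unfolding dH_def
    by (rule derivative_eq_intros bounded_linear.has_derivative[OF bounded_linear_vec_nth] refl | simp)+
       (auto simp: fun_eq_iff inner_commute algebra_simps power2_eq_square)
  then have "(H_kin has_derivative dH) (at (q, \<xi>))"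
  proof (rule has_derivative_transform_within_open)
    show "open (H3 \<times> (UNIV :: (real^3) set))" by (simp add: open_Times open_H3)
    fix y :: cot assume "y \<in> H3 \<times> UNIV"
    then show "(fst y $ 3)\<^sup>2 * (snd y \<bullet> snd y) / 2 = H_kin y"
      by (auto simp: H_kin_def hyp_def sharp_def field_simps power2_eq_square split: prod.splits)
  qed (use assms in simp)
  then have dH: "frechet_derivative H_kin (at (q, \<xi>)) = dH" by (rule frechet_derivative_at[symmetric])
  show ?thesis unfolding ham_vf_def dH
  proof (rule the_equality)
    show "\<forall>Y. omega0 ((q $ 3)\<^sup>2 *\<^sub>R \<xi>, - (q $ 3 * (\<xi> \<bullet> \<xi>)) *\<^sub>R axis 3 1) Y = dH Y"
      by (auto simp: omega0_def dH_def inner_axis')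
    fix X assume X: "\<forall>Y. omega0 X Y = dH Y"
    have "fst X \<bullet> v = ((q $ 3)\<^sup>2 *\<^sub>R \<xi>) \<bullet> v" for v
      using X[rule_format, of "(0, v)"] by (simp add: omega0_def dH_def)
    moreover have "snd X \<bullet> v = (- (q $ 3 * (\<xi> \<bullet> \<xi>)) *\<^sub>R axis 3 1) \<bullet> v" for v
    proof -
      have "- (snd X \<bullet> v) = q $ 3 * v $ 3 * (\<xi> \<bullet> \<xi>)"
        using X[rule_format, of "(v, 0)"] by (simp add: omega0_def dH_def)
      moreover have "(- (q $ 3 * (\<xi> \<bullet> \<xi>)) *\<^sub>R axis 3 1) \<bullet> v = - (q $ 3 * v $ 3 * (\<xi> \<bullet> \<xi>))"
        by (simp add: inner_axis')
      ultimately show ?thesis by linarith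
    qed
    ultimately show "X = ((q $ 3)\<^sup>2 *\<^sub>R \<xi>, - (q $ 3 * (\<xi> \<bullet> \<xi>)) *\<^sub>R axis 3 1)"
      by (metis prod.collapse vector_eq_rdot)
  qed
qed

text \<open>
  Hamilton's equations of the kinetic energy \<open>z^2 |\<xi>|^2 / 2\<close>, for position and momentum separately.
\<close>

definition geodesic_flow :: "real \<Rightarrow> (real \<Rightarrow> real^3) \<Rightarrow> (real \<Rightarrow> real^3) \<Rightarrow> bool" where
  "geodesic_flow b q \<xi> \<longleftrightarrow> (\<forall>t\<in>{0..b}. q t \<in> H3 \<and>
     (q has_vector_derivative (q t $ 3)\<^sup>2 *\<^sub>R \<xi> t) (at t within {0..b}) \<and>
     (\<xi> has_vector_derivative - (q t $ 3 * (\<xi> t \<bullet> \<xi> t)) *\<^sub>R axis 3 1) (at t within {0..b}))"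

lemma chord_lift_flow:
  assumes "chord_lift p x y"
  shows "geodesic_flow 1 (\<lambda>t. fst (y t)) (\<lambda>t. snd (y t))"
  unfolding geodesic_flow_def
proof (intro ballI conjI)
  fix t :: real assume t: "t \<in> {0..1}"
  have y: "y t \<in> cotH3" "(y has_vector_derivative ham_vf H_kin (y t)) (at t within {0..1})"
    using assms t unfolding chord_lift_def by blast+
  show H: "fst (y t) \<in> H3" using y(1) by (auto simp: cotH3_def)
  show "((\<lambda>t. fst (y t)) has_vector_derivative (fst (y t) $ 3)\<^sup>2 *\<^sub>R snd (y t)) (at t within {0..1})"
    using bounded_linear.has_vector_derivative[OF bounded_linear_fst y(2)] ham_vf_H_kin[OF H, of "snd (y t)"] by simp
  show "((\<lambda>t. snd (y t)) has_vector_derivative - (fst (y t) $ 3 * (snd (y t) \<bullet> snd (y t))) *\<^sub>R axis 3 1) (at t within {0..1})"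
    using bounded_linear.has_vector_derivative[OF bounded_linear_snd y(2)] ham_vf_H_kin[OF H, of "snd (y t)"] by simp
qed

text \<open>
  The first formula is the derivative of the eikonal equation in the direction \<open>v\<close>.
\<close>

lemma eikonal_grad_hessian:
  assumes "eikonal f n N" "x \<in> H3"
  shows "n x \<bullet> N x v = - (v $ 3) / (x $ 3) ^ 3" "N x v \<bullet> w = N x w \<bullet> v"
proof -
  have n: "(n has_derivative N x) (at x)" and e: "\<And>x. x \<in> H3 \<Longrightarrow> (x $ 3)\<^sup>2 * (n x \<bullet> n x) = 1"
    using assms unfolding eikonal_def by blast+
  show "N x v \<bullet> w = N x w \<bullet> v"
    by (rule hessian_symmetric[OF open_H3 assms(2) _ n, of f]) (use assms in \<open>simp add: eikonal_def\<close>)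
  have x0: "x $ 3 > 0" using assms(2) by simp
  have "((\<lambda>y. (y $ 3)\<^sup>2 * (n y \<bullet> n y)) has_derivative
      (\<lambda>v. 2 * x $ 3 * v $ 3 * (n x \<bullet> n x) + (x $ 3)\<^sup>2 * (2 * (n x \<bullet> N x v)))) (at x)"
    by (rule derivative_eq_intros bounded_linear.has_derivative[OF bounded_linear_vec_nth] n refl | simp)+
       (auto simp: fun_eq_iff inner_commute algebra_simps)
  then have "(\<lambda>v. 2 * x $ 3 * v $ 3 * (n x \<bullet> n x) + (x $ 3)\<^sup>2 * (2 * (n x \<bullet> N x v))) = (\<lambda>v. 0)"
  proof (rule has_derivative_unique)
    show "((\<lambda>y. (y $ 3)\<^sup>2 * (n y \<bullet> n y)) has_derivative (\<lambda>v. 0)) (at x)"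
      by (rule has_derivative_transform_within_open[OF has_derivative_const[of 1] open_H3 assms(2)]) (simp add: e)
  qed
  from fun_cong[OF this, of v]
  have "2 * x $ 3 * v $ 3 * (n x \<bullet> n x) + (x $ 3)\<^sup>2 * (2 * (n x \<bullet> N x v)) = 0" .
  then have "(x $ 3)\<^sup>2 * (n x \<bullet> N x v) = - (x $ 3 * v $ 3 * (n x \<bullet> n x))" by simp
  also have "n x \<bullet> n x = 1 / (x $ 3)\<^sup>2" using e[OF assms(2)] x0 by (simp add: field_simps)
  finally show "n x \<bullet> N x v = - (v $ 3) / (x $ 3) ^ 3" using x0
    by (simp add: field_simps power2_eq_square power3_eq_cube)
qed

lemma quadratic_form_le_sum_axis:
  fixes L :: "real^3 \<Rightarrow> real^3"
  assumes "linear L"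
  shows "\<bar>L v \<bullet> v\<bar> \<le> (\<Sum>i\<in>UNIV. norm (L (axis i 1))) * (v \<bullet> v)"
proof -
  interpret L: linear L by fact
  have "L v = L (\<Sum>i\<in>UNIV. (v $ i) *\<^sub>R axis i 1)"
    by (simp add: basis_expansion flip: scalar_mult_eq_scaleR)
  also have "\<dots> = (\<Sum>i\<in>UNIV. (v $ i) *\<^sub>R L (axis i 1))" by (simp add: L.sum L.scale)
  finally have Lv: "L v = (\<Sum>i\<in>UNIV. (v $ i) *\<^sub>R L (axis i 1))" .
  have "norm (L v) \<le> (\<Sum>i\<in>UNIV. norm ((v $ i) *\<^sub>R L (axis i 1)))"
    unfolding Lv by (rule norm_sum)
  also have "\<dots> \<le> (\<Sum>i\<in>UNIV. norm v * norm (L (axis i 1)))"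
    by (intro sum_mono) (simp add: mult_right_mono component_le_norm_cart)
  finally have "norm (L v) \<le> (\<Sum>i\<in>UNIV. norm (L (axis i 1))) * norm v"
    by (simp add: sum_distrib_left mult.commute)
  then have "norm (L v) * norm v \<le> (\<Sum>i\<in>UNIV. norm (L (axis i 1))) * norm v * norm v"
    by (rule mult_right_mono) simp
  then show ?thesis using Cauchy_Schwarz_ineq2[of "L v" v]
    by (simp add: power2_norm_eq_inner[symmetric] power2_eq_square mult.assoc)
qed

text \<open>
  The method of characteristics for the eikonal equation. The deviation \<open>\<eta> = \<xi> - k n\<close> of the momentum
  from the multiple of the gradient vanishes initially. Its squared length \<open>W\<close> has a derivative that
  is quadratic in \<open>\<eta>\<close>: the terms linear in \<open>\<eta>\<close> cancel by the differentiated eikonal equation, which is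
  where the symmetry of the Hessian is used. Therefore \<open>W\<close> stays zero, and \<open>f\<close> changes at the
  constant rate \<open>k\<close>.
\<close>

lemma eikonal_characteristic:
  assumes e: "eikonal f n N" and y: "geodesic_flow b q \<xi>" and init: "\<xi> 0 = k *\<^sub>R n (q 0)"
    and t: "t \<in> {0..b}"
  shows "\<xi> t = k *\<^sub>R n (q t)" "f (q t) = f (q 0) + k * t"
proof -
  let ?I = "{0..b}"
  have H: "q t \<in> H3" if "t \<in> ?I" for t using y that unfolding geodesic_flow_def by blast
  have z0: "q t $ 3 > 0" if "t \<in> ?I" for t using H[OF that] by simp
  have dq: "(q has_vector_derivative (q t $ 3)\<^sup>2 *\<^sub>R \<xi> t) (at t within ?I)"
   and d\<xi>: "(\<xi> has_vector_derivative - (q t $ 3 * (\<xi> t \<bullet> \<xi> t)) *\<^sub>R axis 3 1) (at t within ?I)"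
    if "t \<in> ?I" for t using y that unfolding geodesic_flow_def by blast+
  have df: "(f has_derivative (\<lambda>v. n x \<bullet> v)) (at x)" and dn: "(n has_derivative N x) (at x)"
   and nn: "(x $ 3)\<^sup>2 * (n x \<bullet> n x) = 1" if "x \<in> H3" for x
    using e that unfolding eikonal_def by blast+
  have dz: "((\<lambda>t. q t $ 3) has_real_derivative (q t $ 3)\<^sup>2 * \<xi> t $ 3) (at t within ?I)" if "t \<in> ?I" for t
    using bounded_linear.has_vector_derivative[OF bounded_linear_vec_nth dq[OF that], of 3]
    by (simp add: has_real_derivative_iff_has_vector_derivative)
  have dX: "((\<lambda>t. \<xi> t \<bullet> \<xi> t) has_real_derivative - 2 * q t $ 3 * (\<xi> t \<bullet> \<xi> t) * \<xi> t $ 3) (at t within ?I)"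
    if "t \<in> ?I" for t
    using bounded_bilinear.has_vector_derivative[OF bounded_bilinear_inner d\<xi>[OF that] d\<xi>[OF that]]
    by (simp add: has_real_derivative_iff_has_vector_derivative inner_axis inner_axis' algebra_simps)
  have dnq: "((\<lambda>t. n (q t)) has_vector_derivative (q t $ 3)\<^sup>2 *\<^sub>R N (q t) (\<xi> t)) (at t within ?I)"
    if "t \<in> ?I" for t
    using has_vector_derivative_compose[OF dn[OF H[OF that]] dq[OF that]]
      linear_scale[OF has_derivative_linear[OF dn[OF H[OF that]]]] by simp
  have da: "((\<lambda>t. n (q t) \<bullet> \<xi> t) has_real_derivative
      (q t $ 3)\<^sup>2 * (N (q t) (\<xi> t) \<bullet> \<xi> t) - q t $ 3 * (\<xi> t \<bullet> \<xi> t) * n (q t) $ 3) (at t within ?I)"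
    if "t \<in> ?I" for t
    using bounded_bilinear.has_vector_derivative[OF bounded_bilinear_inner dnq[OF that] d\<xi>[OF that]]
    by (simp add: has_real_derivative_iff_has_vector_derivative inner_axis inner_axis' algebra_simps)
  have X: "(q t $ 3)\<^sup>2 * (\<xi> t \<bullet> \<xi> t) = k\<^sup>2" if "t \<in> ?I" for t
  proof -
    have "((\<lambda>t. (q t $ 3)\<^sup>2 * (\<xi> t \<bullet> \<xi> t)) has_real_derivative 0) (at t within ?I)" if "t \<in> ?I" for t
      by (rule derivative_eq_intros dz[OF that] dX[OF that] refl)+ (simp add: power2_eq_square algebra_simps)
    then have "\<exists>c. \<forall>t\<in>?I. (q t $ 3)\<^sup>2 * (\<xi> t \<bullet> \<xi> t) = c"
      by (intro has_field_derivative_zero_constant) auto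
    then have "(q t $ 3)\<^sup>2 * (\<xi> t \<bullet> \<xi> t) = (q 0 $ 3)\<^sup>2 * (\<xi> 0 \<bullet> \<xi> 0)" using that by auto
    also have "\<dots> = k\<^sup>2 * ((q 0 $ 3)\<^sup>2 * (n (q 0) \<bullet> n (q 0)))" by (simp add: init power2_eq_square)
    also have "\<dots> = k\<^sup>2" using nn[OF H[of 0]] that by auto
    finally show ?thesis .
  qed
  \<comment> \<open>As both \<open>\<xi>\<close> and \<open>k n\<close> have length \<open>\<bar>k\<bar>\<close>, the squared length of their difference is this affine
    function of their inner product; it is easier to differentiate in this form.\<close>
  define W where "W = (\<lambda>t. 2 * k\<^sup>2 - 2 * k * ((q t $ 3)\<^sup>2 * (n (q t) \<bullet> \<xi> t)))"
  define \<eta> where "\<eta> = (\<lambda>t. \<xi> t - k *\<^sub>R n (q t))"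
  have W\<eta>: "W t = (q t $ 3)\<^sup>2 * (\<eta> t \<bullet> \<eta> t)" if "t \<in> ?I" for t
  proof -
    have "(q t $ 3)\<^sup>2 * (\<eta> t \<bullet> \<eta> t) = (q t $ 3)\<^sup>2 * (\<xi> t \<bullet> \<xi> t) - 2 * k * ((q t $ 3)\<^sup>2 * (n (q t) \<bullet> \<xi> t))
       + k\<^sup>2 * ((q t $ 3)\<^sup>2 * (n (q t) \<bullet> n (q t)))"
      unfolding \<eta>_def by (simp add: inner_diff inner_commute power2_eq_square algebra_simps)
    then show ?thesis using X[OF that] nn[OF H[OF that]] by (simp add: W_def)
  qed
  define W' where "W' = (\<lambda>t. - 2 * k * (q t $ 3) ^ 4 * (N (q t) (\<eta> t) \<bullet> \<eta> t) + 2 * (q t $ 3) * \<xi> t $ 3 * W t)"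
  have dW: "(W has_real_derivative W' t) (at t within ?I)" if "t \<in> ?I" for t
  proof -
    let ?z = "q t $ 3" and ?N = "N (q t)" and ?n = "n (q t)"
    interpret L: linear ?N using dn[OF H[OF that]] by (rule has_derivative_linear)
    have "\<xi> t = \<eta> t + k *\<^sub>R ?n" by (simp add: \<eta>_def)
    then have "?N (\<xi> t) \<bullet> \<xi> t = (?N (\<eta> t) + k *\<^sub>R ?N ?n) \<bullet> (\<eta> t + k *\<^sub>R ?n)"
      by (metis L.add L.scale)
    also have "\<dots> = ?N (\<eta> t) \<bullet> \<eta> t + 2 * k * (?n \<bullet> ?N (\<eta> t)) + k\<^sup>2 * (?n \<bullet> ?N ?n)"
      using eikonal_grad_hessian(2)[OF e H[OF that], of ?n "\<eta> t"]
      by (simp add: inner_add inner_commute power2_eq_square algebra_simps)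
    also have "\<dots> = ?N (\<eta> t) \<bullet> \<eta> t + 2 * k * (- (\<eta> t $ 3) / ?z ^ 3) + k\<^sup>2 * (- (?n $ 3) / ?z ^ 3)"
      by (simp only: eikonal_grad_hessian(1)[OF e H[OF that]])
    finally have "?z ^ 4 * (?N (\<xi> t) \<bullet> \<xi> t) = ?z ^ 4 * (?N (\<eta> t) \<bullet> \<eta> t)
        + 2 * k * (?z ^ 4 * (- (\<eta> t $ 3) / ?z ^ 3)) + k\<^sup>2 * (?z ^ 4 * (- (?n $ 3) / ?z ^ 3))"
      by (simp only: distrib_left mult.left_commute mult.assoc)
    also have "\<dots> = ?z ^ 4 * (?N (\<eta> t) \<bullet> \<eta> t) + 2 * k * (?z * (- (\<eta> t $ 3))) + k\<^sup>2 * (?z * (- (?n $ 3)))"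
    proof -
      have "?z ^ 4 * (c / ?z ^ 3) = ?z * c" for c
        using z0[OF that] by (simp add: power3_eq_cube power4_eq_xxxx)
      then show ?thesis by (simp only:)
    qed
    also have "\<dots> = ?z ^ 4 * (?N (\<eta> t) \<bullet> \<eta> t) - 2 * k * ?z * \<xi> t $ 3 + k\<^sup>2 * ?z * ?n $ 3"
    proof -
      have "\<eta> t $ 3 = \<xi> t $ 3 - k * ?n $ 3" by (simp add: \<eta>_def)
      then show ?thesis by (simp only:) (simp add: algebra_simps power2_eq_square)
    qed
    finally have N\<xi>: "?z ^ 4 * (?N (\<xi> t) \<bullet> \<xi> t) = ?z ^ 4 * (?N (\<eta> t) \<bullet> \<eta> t) - 2 * k * ?z * \<xi> t $ 3 + k\<^sup>2 * ?z * ?n $ 3" .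
    have "(W has_real_derivative - 2 * k * (2 * ?z ^ 3 * \<xi> t $ 3 * (?n \<bullet> \<xi> t) + ?z ^ 4 * (?N (\<xi> t) \<bullet> \<xi> t)
         - ?z * ?n $ 3 * (?z\<^sup>2 * (\<xi> t \<bullet> \<xi> t)))) (at t within ?I)"
      unfolding W_def
      by (rule derivative_eq_intros dz[OF that] da[OF that] refl)+
         (simp add: power2_eq_square power3_eq_cube power4_eq_xxxx algebra_simps)
    also have "- 2 * k * (2 * ?z ^ 3 * \<xi> t $ 3 * (?n \<bullet> \<xi> t) + ?z ^ 4 * (?N (\<xi> t) \<bullet> \<xi> t)
         - ?z * ?n $ 3 * (?z\<^sup>2 * (\<xi> t \<bullet> \<xi> t))) = W' t"
      unfolding N\<xi> X[OF that] W'_def W_def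
      by (simp add: power2_eq_square power3_eq_cube power4_eq_xxxx algebra_simps)
    finally show ?thesis .
  qed
  have cq: "continuous_on ?I q" and c\<xi>: "continuous_on ?I \<xi>"
    using dq d\<xi> by (meson continuous_on_eq_continuous_within has_vector_derivative_continuous)+
  have cN: "continuous_on ?I (\<lambda>t. N (q t) v)" for v
    by (rule continuous_on_compose2[OF _ cq, of H3 "\<lambda>x. N x v"]) (use e H in \<open>auto simp: eikonal_def\<close>)
  \<comment> \<open>\<open>B\<close> bounds the logarithmic derivative of \<open>W\<close> and is continuous, hence bounded on the interval.\<close>
  define B where "B = (\<lambda>t. 2 * \<bar>k\<bar> * ((q t $ 3)\<^sup>2 * (\<Sum>i\<in>UNIV. norm (N (q t) (axis i 1)))) + 2 * (q t $ 3) * \<xi> t $ 3)"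
  have "continuous_on ?I B" unfolding B_def
    by (intro continuous_intros cN cq c\<xi>)
  then have "bdd_above (B ` ?I)"
    by (intro bounded_imp_bdd_above compact_imp_bounded compact_continuous_image) auto
  then obtain K where K: "\<And>t. t \<in> ?I \<Longrightarrow> B t \<le> K" unfolding bdd_above_def by blast
  have W0: "W t = 0" if "t \<in> ?I" for t
  proof (rule gronwall_zero[OF dW _ _ _ that, of K])
    show Wp: "W t \<ge> 0" if "t \<in> ?I" for t using W\<eta>[OF that] by simp
    show "W 0 = 0" using W\<eta>[of 0] t by (auto simp: \<eta>_def init)
    fix t assume t: "t \<in> ?I"
    let ?S = "\<Sum>i\<in>UNIV. norm (N (q t) (axis i 1))"
    have "- k * (N (q t) (\<eta> t) \<bullet> \<eta> t) \<le> \<bar>k\<bar> * \<bar>N (q t) (\<eta> t) \<bullet> \<eta> t\<bar>"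
      by (metis abs_ge_self abs_minus_cancel abs_mult)
    also have "\<dots> \<le> \<bar>k\<bar> * (?S * (\<eta> t \<bullet> \<eta> t))"
      by (intro mult_left_mono quadratic_form_le_sum_axis has_derivative_linear[OF dn[OF H[OF t]]]) simp
    finally have "(2 * (q t $ 3) ^ 4) * (- k * (N (q t) (\<eta> t) \<bullet> \<eta> t)) \<le> (2 * (q t $ 3) ^ 4) * (\<bar>k\<bar> * (?S * (\<eta> t \<bullet> \<eta> t)))"
      by (rule mult_left_mono) simp
    then have "W' t \<le> B t * W t"
      unfolding W'_def B_def W\<eta>[OF t] by (simp add: algebra_simps power2_eq_square power4_eq_xxxx)
    also have "\<dots> \<le> K * W t" using K[OF t] Wp[OF t] by (rule mult_right_mono)
    finally show "W' t \<le> K * W t" .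
  qed
  have \<xi>: "\<xi> t = k *\<^sub>R n (q t)" if "t \<in> ?I" for t
    using W0[OF that] W\<eta>[OF that] z0[OF that] by (auto simp: \<eta>_def)
  show "\<xi> t = k *\<^sub>R n (q t)" by (rule \<xi>[OF t])
  have "((\<lambda>t. f (q t) - k * t) has_real_derivative 0) (at s within ?I)" if s: "s \<in> ?I" for s
  proof -
    have "((\<lambda>t. f (q t)) has_real_derivative n (q s) \<bullet> ((q s $ 3)\<^sup>2 *\<^sub>R \<xi> s)) (at s within ?I)"
      using has_vector_derivative_compose[OF df[OF H[OF s]] dq[OF s]]
      by (simp add: has_real_derivative_iff_has_vector_derivative)
    also have "n (q s) \<bullet> ((q s $ 3)\<^sup>2 *\<^sub>R \<xi> s) = k * ((q s $ 3)\<^sup>2 * (n (q s) \<bullet> n (q s)))" by (simp add: \<xi>[OF s])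
    also have "\<dots> = k" using nn[OF H[OF s]] by simp
    finally show ?thesis by (auto intro!: derivative_eq_intros)
  qed
  then have "\<exists>c. \<forall>t\<in>?I. f (q t) - k * t = c"
    by (intro has_field_derivative_zero_constant) auto
  then obtain c where c: "\<And>t. t \<in> ?I \<Longrightarrow> f (q t) - k * t = c" by blast
  have "f (q t) - k * t = f (q 0) - k * 0" using c[of t] c[of 0] t by auto
  then show "f (q t) = f (q 0) + k * t" by simp
qed

section \<open>Comparison of a horosphere with a height function\<close>

lemma eikonal_gradient_norm:
  assumes "eikonal f n N" "x \<in> H3"
  shows "norm (n x) = 1 / x $ 3"
proof -
  have "(norm (n x))\<^sup>2 = (1 / x $ 3)\<^sup>2"
    using assms unfolding eikonal_def power2_norm_eq_inner by (auto simp: field_simps)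
  then show ?thesis using assms(2) by (simp add: power2_eq_iff_nonneg)
qed

lemma eikonal_chain:
  assumes "eikonal f n N" "c t \<in> H3" "(c has_vector_derivative v) (at t within A)"
  shows "((\<lambda>t. f (c t)) has_real_derivative n (c t) \<bullet> v) (at t within A)"
  using has_vector_derivative_compose[of f "\<lambda>v. n (c t) \<bullet> v" c t v A] assms
  by (simp add: eikonal_def has_real_derivative_iff_has_vector_derivative)

lemma eikonal_horizontal_lipschitz:
  assumes e: "eikonal f n N" and h: "x $ 3 = h" "y $ 3 = h" "h > 0"
  shows "\<bar>f y - f x\<bar> \<le> norm (y - x) / h"
proof -
  define c where "c = (\<lambda>t::real. x + t *\<^sub>R (y - x))"
  have c3: "c t $ 3 = h" for t using h by (simp add: c_def)
  have "((\<lambda>t. f (c t)) has_real_derivative n (c t) \<bullet> (y - x)) (at t)" for t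
  proof (rule eikonal_chain[OF e])
    show "(c has_vector_derivative y - x) (at t)" unfolding c_def
      by (auto intro!: derivative_eq_intros)
  qed (use c3 h in simp)
  then obtain z where "f (c 1) - f (c 0) = n (c z) \<bullet> (y - x)"
    using MVT2[of 0 1 "\<lambda>t. f (c t)" "\<lambda>t. n (c t) \<bullet> (y - x)"] by auto
  moreover have "\<bar>n (c z) \<bullet> (y - x)\<bar> \<le> norm (n (c z)) * norm (y - x)" by (rule Cauchy_Schwarz_ineq2)
  moreover have "norm (n (c z)) = 1 / h" using eikonal_gradient_norm[OF e, of "c z"] c3 h by simp
  ultimately show ?thesis by (simp add: c_def)
qed

text \<open>
  The vertical unit speed geodesic starting at \<open>q\<close> upwards.
\<close>

definition climb :: "real^3 \<Rightarrow> real \<Rightarrow> real^3" where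
  "climb q t = q + (q $ 3 * (exp t - 1)) *\<^sub>R axis 3 1"

lemma climb_0 [simp]: "climb q 0 = q" and climb_3 [simp]: "climb q t $ 3 = q $ 3 * exp t"
  by (simp_all add: climb_def algebra_simps)

lemma climb_deriv: "(climb q has_vector_derivative (q $ 3 * exp t) *\<^sub>R axis 3 1) (at t within A)"
proof -
  have "((\<lambda>t. q $ 3 * (exp t - 1)) has_real_derivative q $ 3 * exp t) (at t within A)"
    by (auto intro!: derivative_eq_intros)
  note D = has_vector_derivative_scaleR[OF this has_vector_derivative_const[of "axis 3 1 :: real^3"]]
  show ?thesis unfolding climb_def[abs_def] using has_vector_derivative_add[OF has_vector_derivative_const[of q] D] by simp
qed

lemma eikonal_climb_ge:
  assumes e: "eikonal f n N" and q: "q \<in> H3" and t: "t \<ge> 0"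
  shows "f (climb q t) \<ge> f q - t"
proof -
  have H: "climb q s \<in> H3" for s using q by simp
  have "(\<lambda>s. f (climb q s) + s) 0 \<le> (\<lambda>s. f (climb q s) + s) t"
  proof (rule DERIV_nonneg_imp_nondecreasing[OF t])
    fix s
    let ?d = "n (climb q s) \<bullet> ((q $ 3 * exp s) *\<^sub>R axis 3 1)"
    have "((\<lambda>s. f (climb q s) + s) has_real_derivative ?d + 1) (at s)"
      by (intro derivative_intros eikonal_chain[OF e] H climb_deriv)
    moreover have "\<bar>?d\<bar> \<le> norm (n (climb q s)) * norm ((q $ 3 * exp s) *\<^sub>R axis 3 (1::real) :: real^3)"
      by (rule Cauchy_Schwarz_ineq2)
    moreover have "\<dots> = 1" using q eikonal_gradient_norm[OF e H[of s]] by simp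
    ultimately show "\<exists>y. ((\<lambda>s. f (climb q s) + s) has_real_derivative y) (at s) \<and> 0 \<le> y"
      by (intro exI[of _ "?d + 1"]) auto
  qed
  then show ?thesis by simp
qed

text \<open>
  The vertical ray is the characteristic of \<open>f\<close> through \<open>q\<close>. The sign \<open>k\<close> tells whether \<open>f\<close> grows or drops
  along it.
\<close>

lemma eikonal_climb_eq:
  assumes e: "eikonal f n N" and q: "q \<in> H3" and k: "k\<^sup>2 = 1"
    and n: "n q = (k / q $ 3) *\<^sub>R axis 3 1" and t: "t \<ge> 0"
  shows "f (climb q t) = f q + k * t"
proof -
  have q3: "q $ 3 > 0" using q by simp
  have "geodesic_flow t (climb q) (\<lambda>t. (exp (- t) / q $ 3) *\<^sub>R axis 3 1)"
    unfolding geodesic_flow_def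
  proof (intro ballI conjI)
    fix s
    show "climb q s \<in> H3" using q by simp
    have "(climb q s $ 3)\<^sup>2 * (exp (- s) / q $ 3) = q $ 3 * exp s"
      using q3 by (simp add: power2_eq_square exp_minus field_simps)
    then show "(climb q has_vector_derivative (climb q s $ 3)\<^sup>2 *\<^sub>R (exp (- s) / q $ 3) *\<^sub>R (axis 3 1 :: real^3)) (at s within {0..t})"
      using climb_deriv[of q s "{0..t}"] by (metis scaleR_scaleR)
    have eq: "- (climb q s $ 3 * (((exp (- s) / q $ 3) *\<^sub>R (axis 3 1 :: real^3)) \<bullet> (exp (- s) / q $ 3) *\<^sub>R (axis 3 1 :: real^3)))
       = - exp (- s) / q $ 3"
      using q3 by (simp add: inner_axis_axis exp_minus field_simps)
    have "((\<lambda>t. exp (- t) / q $ 3) has_real_derivative - exp (- s) / q $ 3) (at s within {0..t})"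
      by (rule derivative_eq_intros refl | use q3 in simp)+
    then show "((\<lambda>t. (exp (- t) / q $ 3) *\<^sub>R (axis 3 1 :: real^3)) has_vector_derivative
       - (climb q s $ 3 * (((exp (- s) / q $ 3) *\<^sub>R (axis 3 1 :: real^3)) \<bullet> (exp (- s) / q $ 3) *\<^sub>R (axis 3 1 :: real^3))) *\<^sub>R (axis 3 1 :: real^3))
       (at s within {0..t})"
      unfolding eq by (rule has_vector_derivative_scaleR[OF _ has_vector_derivative_const, simplified])
  qed
  moreover have "(exp (- 0) / q $ 3) *\<^sub>R (axis 3 1 :: real^3) = k *\<^sub>R n (climb q 0)"
    using k by (simp add: n power2_eq_square)
  ultimately show ?thesis
    using eikonal_characteristic(2)[OF e, of t "climb q" _ k t] t by simp
qed

text \<open>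
  Climb for time \<open>t\<close> from \<open>q\<close> and from \<open>q'\<close>. Over \<open>q\<close> the function drops by exactly \<open>t\<close>, over \<open>q'\<close> by
  at most \<open>t\<close>, and the two points reached have a hyperbolic distance of order \<open>exp (- t)\<close>. Let \<open>t\<close> tend
  to infinity.
\<close>

lemma eikonal_horosphere_max:
  assumes e: "eikonal f n N" and q: "q \<in> H3" and n: "n q = (- 1 / q $ 3) *\<^sub>R axis 3 1"
    and q': "q' $ 3 = q $ 3"
  shows "f q' \<le> f q"
proof -
  have q3: "q $ 3 > 0" using q by simp
  have "f q' - f q \<le> norm (q' - q) / q $ 3 * exp (- t)" if "t \<ge> 0" for t
  proof -
    have "f q' - t \<le> f (climb q' t)" using eikonal_climb_ge[OF e _ that, of q'] q3 q' by simp
    also have "\<dots> \<le> f (climb q t) + norm (climb q' t - climb q t) / (q $ 3 * exp t)"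
      using eikonal_horizontal_lipschitz[OF e, of "climb q t" "q $ 3 * exp t" "climb q' t"] q3 q' by simp
    also have "f (climb q t) = f q - t" using eikonal_climb_eq[OF e q _ n that] by simp
    also have "climb q' t - climb q t = q' - q" by (simp add: climb_def q')
    finally show ?thesis by (simp add: exp_minus field_simps)
  qed
  then have "\<forall>\<^sub>F t in at_top. f q' - f q \<le> norm (q' - q) / q $ 3 * exp (- t)"
    using eventually_ge_at_top[of 0] by (rule eventually_mono[rotated])
  moreover have "((\<lambda>t. norm (q' - q) / q $ 3 * exp (- t)) \<longlongrightarrow> norm (q' - q) / q $ 3 * 0) at_top"
    by (intro tendsto_intros filterlim_compose[OF exp_at_bot filterlim_uminus_at_bot_at_top])
  ultimately have "f q' - f q \<le> norm (q' - q) / q $ 3 * 0"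
    by (intro tendsto_lowerbound) auto
  then show ?thesis by simp
qed

section \<open>The deck group and the preimage of the horo-torus\<close>

lemma deckD:
  assumes "g \<in> deck p"
  shows "hyp_isometry g" "\<And>q. q \<in> H3 \<Longrightarrow> p (g q) = p q" "\<And>q. q \<in> H3 \<Longrightarrow> g q \<in> H3"
    "continuous_on H3 g"
  using assms isometry_in_H3 smooth_on_imp_continuous_on unfolding deck_def hyp_isometry_def by blast+

lemma horizontal_in_span:
  fixes a b v :: "real^3"
  assumes "a $ 3 = 0" "b $ 3 = 0" "a \<noteq> b" "independent {a, b}" "v $ 3 = 0"
  shows "\<exists>s t. v = s *\<^sub>R a + t *\<^sub>R b"
proof -
  let ?V = "{v :: real^3. axis 3 1 \<bullet> v = 0}"
  have "dim ?V = 2" by (subst dim_hyperplane) auto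
  then have "?V \<subseteq> span {a, b}"
    using assms(1-4) by (intro card_ge_dim_independent) (auto simp: inner_axis')
  then have "v \<in> span {a, b}" using assms(5) by (auto simp: inner_axis')
  then obtain s where "v - s *\<^sub>R a \<in> span {b}" using span_breakdown_eq by blast
  then obtain t where "v - s *\<^sub>R a = t *\<^sub>R b" using span_singleton[of b] by blast
  then have "v = s *\<^sub>R a + t *\<^sub>R b" by (simp add: algebra_simps)
  then show ?thesis by blast
qed

text \<open>
  The covering of a cusped hyperbolic manifold by hyperbolic space, with a chosen height \<open>z0\<close> of the
  horo-torus and a chosen basis \<open>a\<close>, \<open>b\<close> of the cusp lattice.
\<close>

locale horo_torus_cover =
  fixes p :: "real^3 \<Rightarrow> 'm::t2_space" and Q T :: "'m set" and z0 :: real and a b :: "real^3"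
  assumes cov: "covering_space H3 p Q"
    and orbits: "\<And>q q'. q \<in> H3 \<Longrightarrow> q' \<in> H3 \<Longrightarrow> p q = p q' \<Longrightarrow> \<exists>g\<in>deck p. g q = q'"
    and z0: "z0 > 0" and T: "T = p ` {q. q $ 3 = z0}"
    and ab: "a $ 3 = 0" "b $ 3 = 0" "a \<noteq> b" "independent {a, b}"
    and period: "\<And>q. q \<in> H3 \<Longrightarrow> p (q + a) = p q" "\<And>q. q \<in> H3 \<Longrightarrow> p (q + b) = p q"
    and cusp: "\<And>g q. g \<in> deck p \<Longrightarrow> q $ 3 \<ge> z0 \<Longrightarrow> g q $ 3 \<ge> z0 \<Longrightarrow>
       \<exists>m n :: int. \<forall>q\<in>H3. g q = q + of_int m *\<^sub>R a + of_int n *\<^sub>R b"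
begin

lemma lift_unique:
  assumes "continuous_on H3 g" "continuous_on H3 h" "\<And>q. q \<in> H3 \<Longrightarrow> g q \<in> H3" "\<And>q. q \<in> H3 \<Longrightarrow> h q \<in> H3"
    and "\<And>q. q \<in> H3 \<Longrightarrow> p (g q) = p q" "\<And>q. q \<in> H3 \<Longrightarrow> p (h q) = p q"
    and "q0 \<in> H3" "g q0 = h q0" "q \<in> H3"
  shows "g q = h q"
proof (rule covering_space_lift_unique[OF cov, of g q0 h H3 p])
  show "continuous_on H3 p" using cov by (rule covering_space_imp_continuous)
  show "p \<in> H3 \<rightarrow> Q" using covering_space_imp_surjective[OF cov] by blast
qed (use assms connected_H3 in \<open>auto simp del: in_H3\<close>)

text \<open>
  The group structure comes from transitivity on the fibres, which provides a deck transformation,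
  smooth by definition, that agrees with the composition or the inverse at one point. As both lift the
  covering map, they then agree everywhere on \<open>H3\<close>.
\<close>

lemma deck_comp:
  assumes "g \<in> deck p" "h \<in> deck p"
  obtains k where "k \<in> deck p" "\<And>q. q \<in> H3 \<Longrightarrow> k q = g (h q)"
proof -
  have q: "axis 3 1 \<in> H3" by simp
  obtain k where k: "k \<in> deck p" "k (axis 3 1) = g (h (axis 3 1))"
    using orbits[OF q, of "g (h (axis 3 1))"] deckD(2,3)[OF assms(1)] deckD(2,3)[OF assms(2)] q by metis
  have "k q = g (h q)" if "q \<in> H3" for q
  proof (rule lift_unique[OF _ _ _ _ _ _ q _ that])
    show "continuous_on H3 (\<lambda>q. g (h q))"
      using continuous_on_compose2[OF deckD(4)[OF assms(1)] deckD(4)[OF assms(2)]] deckD(3)[OF assms(2)] by blast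
  qed (use k deckD[OF assms(1)] deckD[OF assms(2)] deckD[OF k(1)] in \<open>simp_all del: in_H3\<close>)
  with k show ?thesis using that by blast
qed

lemma deck_id:
  assumes "q0 \<in> H3"
  obtains k where "k \<in> deck p" "\<And>q. q \<in> H3 \<Longrightarrow> k q = q"
proof -
  obtain k where k: "k \<in> deck p" "k q0 = q0" using orbits[OF assms assms] by blast
  have "k q = q" if "q \<in> H3" for q
    by (rule lift_unique[OF _ _ _ _ _ _ assms _ that, of k "\<lambda>q. q"])
      (use k deckD[OF k(1)] in \<open>simp_all del: in_H3\<close>)
  with k show ?thesis using that by blast
qed

lemma deck_inv:
  assumes g: "g \<in> deck p"
  obtains k where "k \<in> deck p" "\<And>q. q \<in> H3 \<Longrightarrow> k (g q) = q" "\<And>q. q \<in> H3 \<Longrightarrow> g (k q) = q"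
proof -
  have q: "axis 3 1 \<in> H3" by simp
  note gq = deckD(3)[OF g q]
  obtain k where k: "k \<in> deck p" "k (g (axis 3 1)) = axis 3 1"
    using orbits[OF gq q] deckD(2)[OF g q] by auto
  have c: "continuous_on H3 (\<lambda>q. k (g q))" "continuous_on H3 (\<lambda>q. g (k q))"
    using continuous_on_compose2[OF deckD(4)[OF g] deckD(4)[OF k(1)]]
      continuous_on_compose2[OF deckD(4)[OF k(1)] deckD(4)[OF g]] deckD(3)[OF g] deckD(3)[OF k(1)] by blast+
  have "k (g q) = q" if "q \<in> H3" for q
    by (rule lift_unique[OF c(1) _ _ _ _ _ q _ that, of "\<lambda>q. q"])
      (use k deckD[OF g] deckD[OF k(1)] in \<open>simp_all del: in_H3\<close>)
  moreover have "g (k q) = q" if "q \<in> H3" for q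
    by (rule lift_unique[OF c(2) _ _ _ _ _ gq _ that, of "\<lambda>q. q"])
      (use k deckD[OF g] deckD[OF k(1)] in \<open>simp_all del: in_H3\<close>)
  ultimately show ?thesis using that k by blast
qed

lemma lift_set_orbit:
  assumes "s \<in> lift_set p T"
  obtains g q where "g \<in> deck p" "q $ 3 = z0" "g q = s"
proof -
  obtain q where q: "q $ 3 = z0" "p s = p q" "s \<in> H3"
    using assms by (auto simp: lift_set_def T)
  then show ?thesis using orbits[of q s] z0 that by auto
qed

lemma deck_horosphere_in_lift_set:
  assumes "g \<in> deck p" "q $ 3 = z0"
  shows "g q \<in> lift_set p T"
  using deckD(2,3)[OF assms(1), of q] assms(2) z0 by (auto simp: lift_set_def T)

lemma deck_lift_set:
  assumes "g \<in> deck p" "s \<in> lift_set p T"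
  shows "g s \<in> lift_set p T"
  using deckD(2,3)[OF assms(1), of s] assms(2) by (simp add: lift_set_def)

lemma cusp_height:
  assumes "g \<in> deck p" "q $ 3 \<ge> z0" "g q $ 3 \<ge> z0" "q' \<in> H3"
  shows "g q' $ 3 = q' $ 3"
  using cusp[OF assms(1-3)] assms(4) ab by auto

text \<open>
  A point at height \<open>z0\<close> or more is the image of a point at height \<open>z0\<close> under a deck transformation,
  which is then a horizontal translation.
\<close>

lemma lift_set_height_le:
  assumes "s \<in> lift_set p T"
  shows "s $ 3 \<le> z0"
proof -
  obtain g q where gq: "g \<in> deck p" "q $ 3 = z0" "g q = s" using lift_set_orbit[OF assms] .
  then show ?thesis using cusp_height[OF gq(1), of q q] z0 by force
qed

lemma lattice_translation_invariant:
  assumes "q \<in> H3"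
  shows "p (q + of_int m *\<^sub>R a + of_int n *\<^sub>R b) = p q"
proof -
  have nat: "p (q + of_nat k *\<^sub>R c) = p q"
    if c: "c $ 3 = 0" "\<And>q. q \<in> H3 \<Longrightarrow> p (q + c) = p q" and q: "q \<in> H3" for c q k
  proof (induction k)
    case (Suc k)
    have "p (q + of_nat k *\<^sub>R c + c) = p (q + of_nat k *\<^sub>R c)" using q c(1) by (intro c(2)) simp
    then show ?case using Suc by (simp add: algebra_simps)
  qed simp
  have int: "p (q + of_int k *\<^sub>R c) = p q"
    if c: "c $ 3 = 0" "\<And>q. q \<in> H3 \<Longrightarrow> p (q + c) = p q" and q: "q \<in> H3" for c q k
  proof (cases "k \<ge> 0")
    case True
    then show ?thesis using nat[OF c q, of "nat k"] by simp
  next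
    case False
    then show ?thesis using nat[OF c, of "q + of_int k *\<^sub>R c" "nat (- k)"] q c(1) by simp
  qed
  show ?thesis using int[OF ab(2) period(2), of "q + of_int m *\<^sub>R a" n] int[OF ab(1) period(1) assms, of m] assms ab(1)
    by simp
qed

lemma horosphere_fundamental_domain:
  obtains F where "compact F" "F \<subseteq> {q. q $ 3 = z0}" "\<And>q. q $ 3 = z0 \<Longrightarrow> \<exists>f\<in>F. p f = p q"
proof -
  define F where "F = (\<lambda>(s, t). z0 *\<^sub>R axis 3 1 + s *\<^sub>R a + t *\<^sub>R b) ` ({0..1::real} \<times> {0..1::real})"
  have "compact F" unfolding F_def
    by (intro compact_continuous_image compact_Times) (auto simp: case_prod_unfold intro!: continuous_intros)
  moreover have "F \<subseteq> {q. q $ 3 = z0}" by (auto simp: F_def ab)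
  moreover have "\<exists>f\<in>F. p f = p q" if q: "q $ 3 = z0" for q
  proof -
    obtain s t where st: "q - z0 *\<^sub>R axis 3 1 = s *\<^sub>R a + t *\<^sub>R b"
      using horizontal_in_span[OF ab, of "q - z0 *\<^sub>R axis 3 1"] q by auto
    define f where "f = z0 *\<^sub>R axis 3 1 + frac s *\<^sub>R a + frac t *\<^sub>R b"
    have "q = f + of_int \<lfloor>s\<rfloor> *\<^sub>R a + of_int \<lfloor>t\<rfloor> *\<^sub>R b"
      using st by (simp add: f_def frac_def algebra_simps)
    moreover have "f \<in> H3" using z0 ab by (simp add: f_def)
    ultimately have "p q = p f" using lattice_translation_invariant by simp
    moreover have "f \<in> F" unfolding F_def f_def
      by (rule image_eqI[of _ _ "(frac s, frac t)"]) (auto simp: frac_ge_0 less_imp_le[OF frac_lt_1])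
    ultimately show ?thesis by metis
  qed
  ultimately show ?thesis using that by blast
qed

text \<open>
  Otherwise points \<open>s k\<close> of other horospheres converge to \<open>q0\<close>. The torus is compact, so they have the
  same images as points \<open>f k\<close> of a fundamental domain that converge along a subsequence. The limit has
  the same image as \<open>q0\<close>, and after a translation by the lattice it is \<open>q0\<close>. Then \<open>f k\<close> and \<open>s k\<close> are
  both close to \<open>q0\<close>, where the covering map is injective, so that \<open>s k\<close> has height \<open>z0\<close>.
\<close>

lemma lift_set_locally_horosphere:
  assumes q0: "q0 $ 3 = z0"
  shows "\<exists>e>0. \<forall>s\<in>lift_set p T. dist s q0 < e \<longrightarrow> s $ 3 = z0"
proof (rule ccontr)
  assume neg: "\<not> ?thesis"
  obtain F where F: "compact F" "F \<subseteq> {q. q $ 3 = z0}" "\<And>q. q $ 3 = z0 \<Longrightarrow> \<exists>f\<in>F. p f = p q"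
    by (rule horosphere_fundamental_domain) blast
  have q0H: "q0 \<in> H3" using q0 z0 by simp
  have "\<exists>s f. s \<in> lift_set p T \<and> dist s q0 < inverse (real (Suc k)) \<and> s $ 3 \<noteq> z0 \<and> f \<in> F \<and> p f = p s" for k
  proof -
    have "inverse (real (Suc k)) > 0" by simp
    then obtain s where s: "s \<in> lift_set p T" "dist s q0 < inverse (real (Suc k))" "s $ 3 \<noteq> z0"
      using neg by blast
    moreover obtain q where "q $ 3 = z0" "p s = p q" using s(1) by (auto simp: lift_set_def T)
    ultimately show ?thesis using F(3)[of q] by metis
  qed
  then obtain s f where s: "\<And>k. s k \<in> lift_set p T" "\<And>k. dist (s k) q0 < inverse (real (Suc k))"
    "\<And>k. s k $ 3 \<noteq> z0" and f: "\<And>k. f k \<in> F" "\<And>k. p (f k) = p (s k)" by metis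
  have sH: "s k \<in> H3" for k using s(1) by (simp add: lift_set_def)
  have sl: "s \<longlonglongrightarrow> q0"
    by (rule metric_tendsto_imp_tendsto[OF LIMSEQ_inverse_real_of_nat])
       (use s(2) in \<open>simp add: less_imp_le\<close>)
  obtain l r where l: "l \<in> F" "strict_mono r" "(f \<circ> r) \<longlonglongrightarrow> l"
    using F(1) f(1) unfolding compact_def by blast
  have lH: "l \<in> H3" using l(1) F(2) z0 by auto
  have fH: "f k \<in> H3" for k using f(1)[of k] F(2) z0 by auto
  have cp: "continuous_on H3 p" by (rule covering_space_imp_continuous[OF cov])
  have sr: "(s \<circ> r) \<longlonglongrightarrow> q0" using sl l(2) by (rule LIMSEQ_subseq_LIMSEQ)
  have "(\<lambda>k. p ((f \<circ> r) k)) \<longlonglongrightarrow> p l"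
    by (rule continuous_on_tendsto_compose[OF cp l(3) lH]) (use fH in auto)
  moreover have "(\<lambda>k. p ((s \<circ> r) k)) \<longlonglongrightarrow> p q0"
    by (rule continuous_on_tendsto_compose[OF cp sr q0H]) (use sH in auto)
  ultimately have "p l = p q0" using f(2) by (simp add: o_def LIMSEQ_unique)
  then obtain g where g: "g \<in> deck p" "g l = q0" using orbits[OF lH q0H] by blast
  have "l $ 3 = z0" using l(1) F(2) by auto
  then obtain m n :: int where mn: "\<And>q. q \<in> H3 \<Longrightarrow> g q = q + of_int m *\<^sub>R a + of_int n *\<^sub>R b"
    using cusp[OF g(1), of l] g(2) q0 by auto
  define c where "c = of_int m *\<^sub>R a + of_int n *\<^sub>R b"
  have "l + c = q0" using mn[OF lH] g(2) by (simp add: c_def add.assoc)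
  then have fl: "(\<lambda>k. (f \<circ> r) k + c) \<longlonglongrightarrow> q0" using tendsto_add[OF l(3) tendsto_const[of c]] by simp
  obtain V u i where V: "q0 \<in> V" "openin (top_of_set H3) V" "homeomorphism V u p i"
    using covering_space_local_homeomorphism[OF cov q0H] by metis
  have oV: "open V" using V(2) open_H3 by (meson openin_open_trans open_openin openin_open_eq)
  have inj: "inj_on p V" using V(3) by (metis homeomorphism_apply1 inj_on_inverseI)
  have "\<forall>\<^sub>F k in sequentially. (s \<circ> r) k \<in> V \<and> (f \<circ> r) k + c \<in> V"
    using topological_tendstoD[OF sr oV V(1)] topological_tendstoD[OF fl oV V(1)] by (rule eventually_conj)
  then obtain k where k: "s (r k) \<in> V" "f (r k) + c \<in> V"
    using eventually_happens[of _ sequentially] by (auto simp: o_def)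
  have "p (f (r k) + c) = p (f (r k))" using lattice_translation_invariant[OF fH] by (simp add: c_def add.assoc)
  then have "p (f (r k) + c) = p (s (r k))" using f(2) by simp
  then have "f (r k) + c = s (r k)" using inj k by (auto dest: inj_onD)
  then have "s (r k) $ 3 = f (r k) $ 3" using ab by (auto simp: c_def simp flip: \<open>f (r k) + c = s (r k)\<close>)
  then show False using s(3)[of "r k"] f(1)[of "r k"] F(2) by auto
qed

text \<open>
  A conormal vector is an orbit, and the point \<open>(q, \<xi>)\<close> of the orbit need not be the one for which
  orthogonality is known. A deck transformation relates the two. The tangent vectors that matter are the
  velocities of the images of horizontal lines in the plane \<open>z = z0\<close>.
\<close>

lemma conormal_orthogonal_horosphere:
  assumes q: "q \<in> H3" and "cot_class p (q, \<xi>) \<in> conormal p T"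
  obtains g q0 where "g \<in> deck p" "q0 $ 3 = z0" "g q0 = q"
    "\<And>v. v $ 3 = 0 \<Longrightarrow> \<xi> \<bullet> frechet_derivative g (at q0) v = 0"
proof -
  let ?S = "lift_set p T"
  obtain q' \<xi>' where q': "cot_class p (q, \<xi>) = cot_class p (q', \<xi>')" "q' \<in> ?S"
    and \<xi>': "\<And>v. v \<in> tangent_vectors ?S q' \<Longrightarrow> \<xi>' \<bullet> v = 0"
    using assms(2) unfolding conormal_def by auto
  obtain i where i: "i \<in> deck p" "\<And>q. q \<in> H3 \<Longrightarrow> i q = q" using deck_id[OF q] by blast
  have "(i has_derivative id) (at q)"
    by (rule has_derivative_transform_within_open[OF has_derivative_id open_H3 q]) (simp add: i(2))
  then have "frechet_derivative i (at q) = id" by (rule frechet_derivative_at[symmetric])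
  moreover have "adjoint (id :: real^3 \<Rightarrow> real^3) = id"
    by (rule adjoint_unique) simp
  ultimately have "cot_lift i (q, \<xi>) = (q, \<xi>)" using i(2)[OF q] by (simp add: cot_lift_def)
  then have "(q, \<xi>) \<in> cot_class p (q, \<xi>)" unfolding cot_class_def using i(1) by (intro CollectI exI[of _ i]) simp
  then have "(q, \<xi>) \<in> cot_class p (q', \<xi>')" by (simp only: q'(1))
  then obtain g where g: "g \<in> deck p" "g q' = q" "\<xi> = adjoint (inv (frechet_derivative g (at q'))) \<xi>'"
    by (auto simp: cot_class_def cot_lift_def)
  have q'H: "q' \<in> H3" using q'(2) by (simp add: lift_set_def)
  define G where "G = frechet_derivative g (at q')"
  have G: "bij G" "linear G" unfolding G_def
    using isometry_deriv_bij[OF deckD(1)[OF g(1)] q'H]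
      has_derivative_linear[OF isometry_has_derivative[OF deckD(1)[OF g(1)] q'H]] by auto
  have li: "linear (inv G)" by (rule inj_linear_imp_inv_linear[OF G(2) bij_is_inj[OF G(1)]])
  have \<xi>G: "\<xi> \<bullet> G v = \<xi>' \<bullet> v" for v
    using adjoint_works[OF li, of "G v" \<xi>'] G(1) by (simp add: g(3) G_def[symmetric] bij_is_inj inner_commute)
  obtain h q0 where h: "h \<in> deck p" "q0 $ 3 = z0" "h q0 = q'" by (rule lift_set_orbit[OF q'(2)])
  have q0H: "q0 \<in> H3" using h(2) z0 by simp
  obtain k where k: "k \<in> deck p" "\<And>q. q \<in> H3 \<Longrightarrow> k q = g (h q)" using deck_comp[OF g(1) h(1)] by blast
  have "\<xi> \<bullet> frechet_derivative k (at q0) v = 0" if v: "v $ 3 = 0" for v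
  proof -
    have "frechet_derivative h (at q0) v \<in> tangent_vectors ?S q'"
      unfolding tangent_vectors_def
    proof (intro CollectI exI conjI)
      let ?c = "\<lambda>s::real. h (q0 + s *\<^sub>R v)"
      show "(0::real) < 1" by simp
      show "smooth_on {- 1<..<1} ?c"
        by (rule smooth_on_subset[OF smooth_on_compose_line[OF _ open_H3]])
           (use deckD(1)[OF h(1)] q0H v in \<open>auto simp: hyp_isometry_def\<close>)
      show "?c ` {- 1<..<1} \<subseteq> ?S"
        using deck_horosphere_in_lift_set[OF h(1)] h(2) v by auto
      show "?c 0 = q'" using h(3) by simp
      have "(?c has_vector_derivative frechet_derivative h (at q0) v) (at 0)"
        by (rule has_vector_derivative_compose)
           (use isometry_has_derivative[OF deckD(1)[OF h(1)] q0H] in \<open>auto intro!: derivative_eq_intros\<close>)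
      then show "vector_derivative ?c (at 0) = frechet_derivative h (at q0) v" by (rule vector_derivative_at)
    qed
    then have "\<xi>' \<bullet> frechet_derivative h (at q0) v = 0" by (rule \<xi>')
    then show ?thesis
      using isometry_compose_derivative[OF deckD(1)[OF g(1)] deckD(1)[OF h(1)] k(2) q0H, of v] \<xi>G
      by (simp add: h(3) G_def)
  qed
  moreover have "k q0 = q" using k(2)[OF q0H] h(3) g(2) by simp
  ultimately show ?thesis using that k(1) h(2) by blast
qed

end

section \<open>The energy and its second variation\<close>

lemma smooth_on_partials:
  fixes F :: "real \<times> real \<Rightarrow> 'b::euclidean_space"
  assumes "smooth_on W F" "(s, t) \<in> W"
  shows "((\<lambda>s. F (s, t)) has_vector_derivative frechet_derivative F (at (s, t)) (1, 0)) (at s)"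
    "((\<lambda>t. F (s, t)) has_vector_derivative frechet_derivative F (at (s, t)) (0, 1)) (at t)"
proof -
  note D = smooth_on_has_derivative[OF assms]
  have "((\<lambda>s. (s, t)) has_vector_derivative (1, 0)) (at s)"
    by (auto intro!: derivative_eq_intros simp: has_vector_derivative_def)
  from has_vector_derivative_compose[of F _ "\<lambda>s. (s, t)", OF D this]
  show "((\<lambda>s. F (s, t)) has_vector_derivative frechet_derivative F (at (s, t)) (1, 0)) (at s)" .
  have "((\<lambda>t. (s, t)) has_vector_derivative (0, 1)) (at t)"
    by (auto intro!: derivative_eq_intros simp: has_vector_derivative_def)
  from has_vector_derivative_compose[of F _ "\<lambda>t. (s, t)", OF D this]
  show "((\<lambda>t. F (s, t)) has_vector_derivative frechet_derivative F (at (s, t)) (0, 1)) (at t)" .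
qed

text \<open>
  Let \<open>h\<close> be the function \<open>f\<close> along the path. As \<open>|df| = 1\<close>, the squared speed is at least
  \<open>h'^2 \<ge> - 2 L h' - L^2\<close>. The integral of the right-hand side is \<open>2 L (h 0 - h 1) - L^2 \<ge> L^2\<close>.
\<close>

lemma energy_lower_bound:
  assumes e: "eikonal f n N" and H: "\<And>t. t \<in> {0..1} \<Longrightarrow> c t \<in> H3"
    and dc: "\<And>t. t \<in> {0..1} \<Longrightarrow> (c has_vector_derivative v t) (at t)"
    and v: "continuous_on {0..1} v" and L: "L \<ge> 0" "f (c 1) \<le> f (c 0) - L"
  shows "L\<^sup>2 / 2 \<le> energy c"
proof -
  have "((\<lambda>t. - 2 * L * (n (c t) \<bullet> v t) - L\<^sup>2) has_integral
     ((- 2 * L * f (c 1) - L\<^sup>2 * 1) - (- 2 * L * f (c 0) - L\<^sup>2 * 0))) {0..1}"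
  proof (rule fundamental_theorem_of_calculus)
    fix t :: real assume t: "t \<in> {0..1}"
    have "((\<lambda>t. f (c t)) has_real_derivative n (c t) \<bullet> v t) (at t within {0..1})"
      by (rule eikonal_chain[OF e H[OF t] has_vector_derivative_at_within[OF dc[OF t]]])
    then have "((\<lambda>t. - 2 * L * f (c t) - L\<^sup>2 * t) has_real_derivative - 2 * L * (n (c t) \<bullet> v t) - L\<^sup>2) (at t within {0..1})"
      by (auto intro!: derivative_eq_intros)
    then show "((\<lambda>t. - 2 * L * f (c t) - L\<^sup>2 * t) has_vector_derivative - 2 * L * (n (c t) \<bullet> v t) - L\<^sup>2) (at t within {0..1})"
      by (simp add: has_real_derivative_iff_has_vector_derivative)
  qed simp
  moreover have "((\<lambda>t. hyp (c t) (vector_derivative c (at t)) (vector_derivative c (at t))) has_integral 2 * energy c) {0..1}"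
  proof -
    have cc: "continuous_on {0..1} c"
      using dc by (meson continuous_at_imp_continuous_on has_vector_derivative_continuous)
    have "continuous_on {0..1} (\<lambda>t. hyp (c t) (v t) (v t))"
      unfolding hyp_def using H by (intro continuous_intros cc v) fastforce
    then have "continuous_on {0..1} (\<lambda>t. hyp (c t) (vector_derivative c (at t)) (vector_derivative c (at t)))"
      by (rule continuous_on_eq) (simp add: vector_derivative_at[OF dc])
    then show ?thesis unfolding energy_def
      using integrable_integral[OF integrable_continuous_interval] by fastforce
  qed
  ultimately have "(- 2 * L * f (c 1) - L\<^sup>2 * 1) - (- 2 * L * f (c 0) - L\<^sup>2 * 0) \<le> 2 * energy c"
  proof (rule has_integral_le)
    fix t :: real assume t: "t \<in> {0..1}"
    have z: "c t $ 3 > 0" using H[OF t] by simp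
    let ?d = "n (c t) \<bullet> v t"
    have "?d\<^sup>2 \<le> (n (c t) \<bullet> n (c t)) * (v t \<bullet> v t)" by (rule Cauchy_Schwarz_ineq)
    also have "n (c t) \<bullet> n (c t) = 1 / (c t $ 3)\<^sup>2"
      using eikonal_gradient_norm[OF e H[OF t]] by (simp add: power2_norm_eq_inner[symmetric] power_divide)
    finally have "?d\<^sup>2 \<le> hyp (c t) (v t) (v t)" by (simp add: hyp_def)
    moreover have "- 2 * L * ?d - L\<^sup>2 \<le> ?d\<^sup>2"
      using zero_le_power2[of "?d + L"] by (simp add: power2_sum algebra_simps)
    ultimately show "- 2 * L * ?d - L\<^sup>2 \<le> hyp (c t) (vector_derivative c (at t)) (vector_derivative c (at t))"
      by (simp add: vector_derivative_at[OF dc[OF t]])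
  qed
  moreover have "2 * L * L \<le> 2 * L * (f (c 0) - f (c 1))" using L by (intro mult_left_mono) auto
  ultimately show ?thesis by (simp add: power2_eq_square algebra_simps)
qed

lemma energy_characteristic:
  assumes e: "eikonal f n N" and fl: "geodesic_flow 1 q \<xi>" and \<kappa>: "\<xi> 0 = \<kappa> *\<^sub>R n (q 0)"
    and c: "\<And>t. t \<in> {0..1} \<Longrightarrow> c t = q t"
  shows "energy c = \<kappa>\<^sup>2 / 2"
proof -
  have "integral {0..1} (\<lambda>t. hyp (c t) (vector_derivative c (at t)) (vector_derivative c (at t)))
      = integral {0..1} (\<lambda>t::real. \<kappa>\<^sup>2)"
  \<comment> \<open>Outside \<open>{0..1}\<close> the path is arbitrary, so its derivative is known only in the interior.\<close>
  proof (rule integral_spike[of "{0, 1}"])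
    fix t :: real assume t: "t \<in> {0..1} - {0, 1}"
    then have t': "t \<in> {0..1}" by simp
    have qH: "q t \<in> H3" using fl t' by (auto simp: geodesic_flow_def)
    have "at t within {0..1} = at t" using t by (intro at_within_interior) auto
    then have "(q has_vector_derivative (q t $ 3)\<^sup>2 *\<^sub>R \<xi> t) (at t)"
      using fl t' unfolding geodesic_flow_def by metis
    then have "(c has_vector_derivative (q t $ 3)\<^sup>2 *\<^sub>R \<xi> t) (at t)"
      by (rule has_vector_derivative_transform_within_open[of _ _ _ "{0<..<1}"]) (use t c in auto)
    then have vd: "vector_derivative c (at t) = (q t $ 3)\<^sup>2 *\<^sub>R \<kappa> *\<^sub>R n (q t)"
      using eikonal_characteristic(1)[OF e fl \<kappa> t'] by (simp add: vector_derivative_at)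
    have "(q t $ 3)\<^sup>2 * (n (q t) \<bullet> n (q t)) = 1" using e qH by (simp add: eikonal_def)
    moreover have "hyp (c t) ((q t $ 3)\<^sup>2 *\<^sub>R \<kappa> *\<^sub>R n (q t)) ((q t $ 3)\<^sup>2 *\<^sub>R \<kappa> *\<^sub>R n (q t))
       = \<kappa>\<^sup>2 * ((q t $ 3)\<^sup>2 * (n (q t) \<bullet> n (q t)))"
      using qH by (simp add: hyp_def c[OF t'] power2_eq_square)
    ultimately show "\<kappa>\<^sup>2 = hyp (c t) (vector_derivative c (at t)) (vector_derivative c (at t))"
      unfolding vd by simp
  qed simp
  then show ?thesis by (simp add: energy_def)
qed

text \<open>
  By compactness of the interval, the domain of a variation contains a product neighbourhood.
\<close>

lemma variation_tube:
  assumes "variation S c C"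
  obtains d F where "d > 0" "smooth_on ({-d<..<d} \<times> {0..1}) F" "F = (\<lambda>(s, t). C s t)"
    "\<And>s t. s \<in> {-d<..<d} \<Longrightarrow> t \<in> {0..1} \<Longrightarrow> C s t \<in> H3"
    "\<And>s. s \<in> {-d<..<d} \<Longrightarrow> C s 0 \<in> S" "\<And>s. s \<in> {-d<..<d} \<Longrightarrow> C s 1 \<in> S"
proof -
  obtain W where W: "open W" "{0} \<times> {0..1} \<subseteq> W" "smooth_on W (\<lambda>(s, t). C s t)"
    "\<forall>(s, t)\<in>W. C s t \<in> H3"
    "\<forall>s. (s, 0) \<in> W \<longrightarrow> C s 0 \<in> S" "\<forall>s. (s, 1) \<in> W \<longrightarrow> C s 1 \<in> S"
    using assms unfolding variation_def by (elim conjE exE)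
  obtain X where X: "0 \<in> X" "open X" "X \<times> {0..1} \<subseteq> W"
    using Elementary_Topology.tube_lemma[OF compact_Icc W(1,2)] by blast
  obtain d where d: "d > 0" "ball 0 d \<subseteq> X" using X open_contains_ball by blast
  have W': "(s, t) \<in> W" if "s \<in> {-d<..<d}" "t \<in> {0..1}" for s t
  proof -
    have "s \<in> X" using that d(2) by (auto simp: dist_real_def)
    then show ?thesis using X(3) that(2) by blast
  qed
  show ?thesis
  proof (rule that[OF d(1) smooth_on_subset[OF W(3)] refl])
    show "{-d<..<d} \<times> {0..1} \<subseteq> W" using W' by blast
    fix s assume s: "s \<in> {-d<..<d}"
    show "C s 0 \<in> S" "C s 1 \<in> S" using W(5,6) W'[OF s, of 0] W'[OF s, of 1] by simp_all
    show "C s t \<in> H3" if "t \<in> {0..1}" for t using W(4) W'[OF s that] by blast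
  qed
qed

text \<open>
  Differentiation under the integral sign, twice. The integrand is \<open>|u|^2 / z^2\<close> for the velocity \<open>u\<close> and
  the height \<open>z\<close>; its derivatives \<open>G1\<close> and \<open>G2\<close> in the variation parameter are written out to see that they
  are continuous.
\<close>

lemma energy_twice_differentiable:
  fixes C :: "real \<Rightarrow> real \<Rightarrow> real^3"
  assumes d: "d > 0" and sm: "smooth_on ({-d<..<d} \<times> {0..1}) F" and F: "F = (\<lambda>(s, t). C s t)"
    and H: "\<And>s t. s \<in> {-d<..<d} \<Longrightarrow> t \<in> {0..1} \<Longrightarrow> C s t \<in> H3"
  obtains E' E'' where "\<And>s. s \<in> {-d<..<d} \<Longrightarrow> ((\<lambda>s. energy (C s)) has_real_derivative E' s) (at s)"
    "(E' has_real_derivative E'') (at 0)"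
proof -
  let ?U = "{-d<..<d}" and ?W = "{-d<..<d} \<times> {0..1::real}"
  define D where "D = (\<lambda>(f :: real \<times> real \<Rightarrow> real^3) v x. frechet_derivative f (at x) v)"
  have smD: "smooth_on ?W (D f v)" if "smooth_on ?W f" for f v
    unfolding D_def using smooth_on_deriv[OF that] by simp
  have Ds: "((\<lambda>s. f (s, t)) has_vector_derivative D f (1, 0) (s, t)) (at s)"
    if "smooth_on ?W f" "(s, t) \<in> ?W" for f s t
    using smooth_on_partials(1)[OF that] by (simp add: D_def)
  define u where "u = D F (0, 1)"
  define u1 where "u1 = D u (1, 0)"
  define u2 where "u2 = D u1 (1, 0)"
  define F1 where "F1 = D F (1, 0)"
  define F2 where "F2 = D F1 (1, 0)"
  have sm': "smooth_on ?W u" "smooth_on ?W u1" "smooth_on ?W u2" "smooth_on ?W F1" "smooth_on ?W F2"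
    unfolding u_def u1_def u2_def F1_def F2_def by (intro smD sm)+
  note cont = smooth_on_imp_continuous_on[OF sm] sm'[THEN smooth_on_imp_continuous_on]
  have F3: "F x $ 3 > 0" if "x \<in> ?W" for x using H that by (auto simp: F)
  define i where "i = (\<lambda>x. inverse (F x $ 3))"
  define G where "G = (\<lambda>x. (u x \<bullet> u x) * i x ^ 2)"
  define G1 where "G1 = (\<lambda>x. 2 * (u x \<bullet> u1 x) * i x ^ 2 - 2 * ((u x \<bullet> u x) * F1 x $ 3 * i x ^ 3))"
  define G2 where "G2 = (\<lambda>x. (2 * (u1 x \<bullet> u1 x + u x \<bullet> u2 x) * i x ^ 2 - 2 * (2 * (u x \<bullet> u1 x) * F1 x $ 3 * i x ^ 3))
      - 2 * ((2 * (u x \<bullet> u1 x) * F1 x $ 3 + (u x \<bullet> u x) * F2 x $ 3) * i x ^ 3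
        - 3 * ((u x \<bullet> u x) * F1 x $ 3 * F1 x $ 3 * i x ^ 4)))"
  have inner: "((\<lambda>s. a s \<bullet> b s) has_real_derivative (a s \<bullet> b' + a' \<bullet> b s)) (at s)"
    if "(a has_vector_derivative a') (at s)" "(b has_vector_derivative b') (at s)" for a b :: "real \<Rightarrow> real^3" and a' b' s
    using bounded_bilinear.has_vector_derivative[OF bounded_bilinear_inner that]
    by (simp add: has_real_derivative_iff_has_vector_derivative)
  have comp: "((\<lambda>s. a s $ 3) has_real_derivative a' $ 3) (at s)"
    if "(a has_vector_derivative a') (at s)" for a :: "real \<Rightarrow> real^3" and a' s
    using bounded_linear.has_vector_derivative[OF bounded_linear_vec_nth that]
    by (simp add: has_real_derivative_iff_has_vector_derivative)
  have dG: "((\<lambda>s. G (s, t)) has_real_derivative G1 (s, t)) (at s)"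
   and dG1: "((\<lambda>s. G1 (s, t)) has_real_derivative G2 (s, t)) (at s)"
    if st: "(s, t) \<in> ?W" for s t
  proof -
    have z: "F (s, t) $ 3 \<noteq> 0" using F3[OF st] by simp
    have u: "((\<lambda>s. u (s, t)) has_vector_derivative u1 (s, t)) (at s)" unfolding u1_def by (rule Ds[OF sm'(1) st])
    have u1: "((\<lambda>s. u1 (s, t)) has_vector_derivative u2 (s, t)) (at s)" unfolding u2_def by (rule Ds[OF sm'(2) st])
    have dF: "((\<lambda>s. F (s, t) $ 3) has_real_derivative F1 (s, t) $ 3) (at s)"
      unfolding F1_def by (rule comp[OF Ds[OF sm st]])
    have dF1: "((\<lambda>s. F1 (s, t) $ 3) has_real_derivative F2 (s, t) $ 3) (at s)"
      unfolding F2_def by (rule comp[OF Ds[OF sm'(4) st]])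
    have di: "((\<lambda>s. a s * i (s, t) ^ k) has_real_derivative
        a' * i (s, t) ^ k - real k * (a s * F1 (s, t) $ 3 * i (s, t) ^ Suc k)) (at s)"
      if a: "(a has_real_derivative a') (at s)" and "k > 0" for a :: "real \<Rightarrow> real" and a' k
    proof -
      obtain j where k: "k = Suc j" using \<open>k > 0\<close> gr0_conv_Suc by blast
      have "((\<lambda>s. i (s, t)) has_real_derivative - (i (s, t) * F1 (s, t) $ 3 * i (s, t))) (at s)"
        unfolding i_def by (rule DERIV_inverse'[OF dF z])
      note D = DERIV_mult[OF a DERIV_power[OF this, of k]]
      show ?thesis by (rule DERIV_cong[OF D]) (simp add: k algebra_simps)
    qed
    have Q: "((\<lambda>s. u (s, t) \<bullet> u (s, t)) has_real_derivative 2 * (u (s, t) \<bullet> u1 (s, t))) (at s)"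
      by (rule DERIV_cong[OF inner[OF u u]]) (simp add: inner_commute)
    have Q1: "((\<lambda>s. 2 * (u (s, t) \<bullet> u1 (s, t))) has_real_derivative
        2 * (u1 (s, t) \<bullet> u1 (s, t) + u (s, t) \<bullet> u2 (s, t))) (at s)"
      by (rule DERIV_cong[OF DERIV_cmult[OF inner[OF u u1]]]) (simp add: inner_commute)
    have QF: "((\<lambda>s. (u (s, t) \<bullet> u (s, t)) * F1 (s, t) $ 3) has_real_derivative
        2 * (u (s, t) \<bullet> u1 (s, t)) * F1 (s, t) $ 3 + (u (s, t) \<bullet> u (s, t)) * F2 (s, t) $ 3) (at s)"
      by (rule DERIV_cong[OF DERIV_mult[OF Q dF1]]) simp
    show "((\<lambda>s. G (s, t)) has_real_derivative G1 (s, t)) (at s)" unfolding G_def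
      by (rule DERIV_cong[OF di[OF Q]]) (simp_all add: G1_def)
    show "((\<lambda>s. G1 (s, t)) has_real_derivative G2 (s, t)) (at s)" unfolding G1_def
      by (rule DERIV_cong[OF DERIV_diff[OF di[OF Q1] DERIV_cmult[OF di[OF QF]]]]) (simp_all add: G2_def)
  qed
  have cG: "continuous_on ?W G" "continuous_on ?W G1" "continuous_on ?W G2"
  proof -
    have "continuous_on ?W i" unfolding i_def
      by (intro continuous_intros cont) (use F3 in fastforce)
    then show "continuous_on ?W G" "continuous_on ?W G1" "continuous_on ?W G2"
      unfolding G_def G1_def G2_def by (intro continuous_intros cont; assumption)+
  qed
  have int: "(\<lambda>t. g (s, t)) integrable_on cbox 0 1" if "continuous_on ?W g" "s \<in> ?U" for g :: "real \<times> real \<Rightarrow> real" and s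
    unfolding cbox_interval
    by (intro integrable_continuous_interval continuous_on_compose2[OF that(1)] continuous_intros) (use that(2) in auto)
  define I where "I = (\<lambda>(g :: real \<times> real \<Rightarrow> real) s. 1/2 * integral {0..1::real} (\<lambda>t. g (s, t) :: real))"
  have leib: "(I g has_real_derivative I g' s) (at s)"
    if "\<And>s t. (s, t) \<in> ?W \<Longrightarrow> ((\<lambda>s. g (s, t)) has_real_derivative g' (s, t)) (at s)"
      "continuous_on ?W g" "continuous_on ?W g'" "s \<in> ?U" for g g' s
  proof -
    have "((\<lambda>s. integral (cbox 0 1) (\<lambda>t. g (s, t))) has_real_derivative integral (cbox 0 1) (\<lambda>t. g' (s, t))) (at s within ?U)"
    proof (rule leibniz_rule_field_derivative)
      show "continuous_on (?U \<times> cbox 0 1) (\<lambda>(x, t). g' (x, t))" using that(3) by simp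
      fix x t :: real assume "x \<in> ?U" "t \<in> cbox 0 1"
      then show "((\<lambda>x. g (x, t)) has_real_derivative g' (x, t)) (at x within ?U)"
        by (intro has_field_derivative_at_within[OF that(1)]) auto
    qed (use int[OF that(2)] that(4) in auto)
    moreover have "at s within ?U = at s" using that(4) by (intro at_within_open) auto
    ultimately show ?thesis unfolding I_def by (auto intro!: derivative_eq_intros)
  qed
  have E: "energy (C s) = I G s" if s: "s \<in> ?U" for s
  proof -
    have "hyp (C s t) (vector_derivative (C s) (at t)) (vector_derivative (C s) (at t)) = G (s, t)" if t: "t \<in> {0..1}" for t
    proof -
      have "(s, t) \<in> ?W" using s t by simp
      from smooth_on_partials(2)[OF sm this] have "(C s has_vector_derivative u (s, t)) (at t)"
        by (simp add: F u_def D_def)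
      then show ?thesis by (simp add: vector_derivative_at hyp_def G_def F i_def divide_inverse power_inverse)
    qed
    then have "integral {0..1} (\<lambda>t. hyp (C s t) (vector_derivative (C s) (at t)) (vector_derivative (C s) (at t)))
        = integral {0..1} (\<lambda>t. G (s, t))" by (rule integral_cong)
    then show ?thesis by (simp add: energy_def I_def)
  qed
  have "((\<lambda>s. energy (C s)) has_real_derivative I G1 s) (at s)" if "s \<in> ?U" for s
    by (rule has_field_derivative_transform_within_open[OF leib[OF dG cG(1,2) that] _ that]) (auto simp: E)
  moreover have "(I G1 has_real_derivative I G2 0) (at 0)"
    by (rule leib[OF dG1 cG(2,3)]) (use d in auto)
  ultimately show ?thesis using that by blast
qed

lemma second_variation_nonneg:
  assumes C: "variation S c C" and min: "\<forall>\<^sub>F s in nhds 0. energy (C 0) \<le> energy (C s)"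
  shows "deriv (deriv (\<lambda>s. energy (C s))) 0 \<ge> 0"
proof -
  obtain d F where dF: "d > 0" "smooth_on ({-d<..<d} \<times> {0..1}) F" "F = (\<lambda>(s, t). C s t)"
    "\<And>s t. s \<in> {-d<..<d} \<Longrightarrow> t \<in> {0..1} \<Longrightarrow> C s t \<in> H3"
    by (rule variation_tube[OF C]) blast
  obtain E' E'' where E: "\<And>s. s \<in> {-d<..<d} \<Longrightarrow> ((\<lambda>s. energy (C s)) has_real_derivative E' s) (at s)"
    "(E' has_real_derivative E'') (at 0)"
    by (rule energy_twice_differentiable[OF dF]) blast+
  obtain r where r: "r > 0" "\<And>s. dist s 0 < r \<Longrightarrow> energy (C 0) \<le> energy (C s)"
    using min unfolding eventually_nhds_metric by blast
  have "0 < min d r" using dF(1) r(1) by simp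
  moreover have "((\<lambda>s. energy (C s)) has_real_derivative E' s) (at s)" if "\<bar>s\<bar> < min d r" for s
    using that by (intro E(1)) auto
  moreover have "energy (C 0) \<le> energy (C s)" if "\<bar>s\<bar> < min d r" for s
    using that by (intro r(2)) simp
  ultimately have "deriv (deriv (\<lambda>s. energy (C s))) 0 = E''" "E'' \<ge> 0"
    using local_min_second_derivative[of "min d r" "\<lambda>s. energy (C s)" E' E''] E(2) by blast+
  then show ?thesis by simp
qed

section \<open>Geodesic cords of the horo-torus are minimal\<close>

context horo_torus_cover begin

lemma log_height_lift_set_le:
  assumes "k \<in> deck p" "s \<in> lift_set p T"
  shows "log_height k s \<le> ln z0"
proof -
  have "s \<in> H3" using assms(2) by (simp add: lift_set_def)
  then have "0 < k s $ 3" using deckD(3)[OF assms(1)] by simp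
  then show ?thesis using lift_set_height_le[OF deck_lift_set[OF assms]] z0 by (simp add: log_height_def)
qed

text \<open>
  Two horospheres of the preimage of the torus: the one whose points \<open>s\<close> satisfy
  \<open>log_height k0 s = ln z0\<close>, and the image under \<open>g1\<close> of the horosphere \<open>z = z0\<close>. If the
  latter is orthogonal to the gradient of \<open>log_height k0\<close> at \<open>g1 a1\<close>, then \<open>g1 a1\<close> is its
  point nearest to the former. In the coordinates of \<open>g1\<close> the gradient is vertical at \<open>a1\<close>.
  When it points down, this is the comparison of a horosphere with a height function. If it
  pointed up, the vertical line over \<open>a1\<close> would be carried by \<open>k0 \<circ> g1\<close> back into the horoball
  \<open>z \<ge> z0\<close>, so that \<open>k0 \<circ> g1\<close> would be a horizontal translation, which keeps the height. For \<open>L = 0\<close>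
  the bound holds on the whole preimage.
\<close>

lemma far_horosphere_height_le:
  assumes k0: "k0 \<in> deck p" and g1: "g1 \<in> deck p" "a1 $ 3 = z0" and a2: "a2 $ 3 = z0" and L: "L \<ge> 0"
    and f1: "log_height k0 (g1 a1) = ln z0 - L"
    and orth: "\<And>v. v $ 3 = 0 \<Longrightarrow> L \<noteq> 0 \<Longrightarrow> grad_log_height k0 (g1 a1) \<bullet> frechet_derivative g1 (at a1) v = 0"
  shows "log_height k0 (g1 a2) \<le> ln z0 - L"
proof (cases "L = 0")
  case True
  then show ?thesis using log_height_lift_set_le[OF k0 deck_horosphere_in_lift_set[OF g1(1) a2]] by simp
next
  case False
  have aH: "a1 \<in> H3" using g1(2) z0 by simp
  obtain k where k: "k \<in> deck p" "\<And>q. q \<in> H3 \<Longrightarrow> k q = k0 (g1 q)" using deck_comp[OF k0 g1(1)] by blast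
  have fk: "log_height k q = log_height k0 (g1 q)" if "q \<in> H3" for q
    using k(2)[OF that] by (simp add: log_height_def)
  define nk where "nk = grad_log_height k"
  obtain Nk where ek: "eikonal (log_height k) nk Nk"
    using eikonal_log_height[OF deckD(1)[OF k(1)]] by (auto simp: nk_def)
  have fka: "log_height k a1 = ln z0 - L" using fk[OF aH] f1 by simp
  have "nk a1 \<bullet> v = 0" if v: "v $ 3 = 0" for v
  proof -
    let ?w = "frechet_derivative g1 (at a1) v"
    have "nk a1 \<bullet> v = grad_log_height k0 (g1 a1) \<bullet> ?w"
      using grad_log_height_inner[OF deckD(1)[OF k(1)] aH, of v] k(2)[OF aH]
        grad_log_height_inner[OF deckD(1)[OF k0] deckD(3)[OF g1(1) aH], of ?w]
        isometry_compose_derivative[OF deckD(1)[OF k0] deckD(1)[OF g1(1)] k(2) aH, of v]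
      by (simp add: nk_def)
    then show ?thesis using orth[OF v False] by simp
  qed
  from this[of "nk a1 - (nk a1 $ 3) *\<^sub>R axis 3 1"]
  have "(nk a1 - (nk a1 $ 3) *\<^sub>R axis 3 1) \<bullet> (nk a1 - (nk a1 $ 3) *\<^sub>R axis 3 1) = 0"
    by (simp add: inner_diff_left inner_axis')
  then have nk: "nk a1 = (nk a1 $ 3) *\<^sub>R axis 3 1" by simp
  then have "norm (nk a1) = \<bar>nk a1 $ 3\<bar>" by (metis norm_axis_1 norm_scaleR mult.right_neutral)
  then have "\<bar>nk a1 $ 3\<bar> = 1 / z0" using eikonal_gradient_norm[OF ek aH] g1(2) by simp
  then consider "nk a1 $ 3 = 1 / z0" | "nk a1 $ 3 = - 1 / z0" by linarith
  then show ?thesis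
  proof cases
    case 1
    then have "nk a1 = (1 / a1 $ 3) *\<^sub>R axis 3 1" using nk g1(2) by simp
    from eikonal_climb_eq[OF ek aH _ this L]
    have "log_height k (climb a1 L) = ln z0" using fka by simp
    moreover have cH: "climb a1 L \<in> H3" using g1(2) z0 by simp
    then have "0 < k (climb a1 L) $ 3" using deckD(3)[OF k(1)] by simp
    ultimately have "k (climb a1 L) $ 3 = z0" using z0 by (simp add: log_height_def)
    moreover have "climb a1 L $ 3 \<ge> z0" using g1(2) z0 L by simp
    ultimately have "k a1 $ 3 = a1 $ 3" using cusp_height[OF k(1), of "climb a1 L" a1] aH by simp
    then have "ln z0 = ln z0 - L" using fka g1(2) by (simp add: log_height_def)
    then show ?thesis using False by simp
  next
    case 2
    then have "nk a1 = (- 1 / a1 $ 3) *\<^sub>R axis 3 1" using nk g1(2) by simp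
    from eikonal_horosphere_max[OF ek aH this, of a2]
    have "log_height k a2 \<le> ln z0 - L" using fka a2 g1(2) by simp
    then show ?thesis using fk[of a2] a2 z0 by simp
  qed
qed

text \<open>
  This holds because the preimage of the torus is locally a single horosphere. Hence the endpoints of
  nearby paths in a variation lie on the two horospheres joined by the cord.
\<close>

lemma curve_stays_on_horosphere:
  assumes k: "k \<in> deck p" "k (c 0) = q0" "q0 $ 3 = z0"
    and c: "isCont c (0::real)" "c 0 \<in> H3" "\<forall>\<^sub>F s in nhds 0. c s \<in> lift_set p T"
  shows "\<forall>\<^sub>F s in nhds 0. k (c s) $ 3 = z0"
proof -
  obtain r where r: "r > 0" "\<And>s. s \<in> lift_set p T \<Longrightarrow> dist s q0 < r \<Longrightarrow> s $ 3 = z0"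
    using lift_set_locally_horosphere[OF k(3)] by blast
  have "isCont k (c 0)"
    using has_derivative_continuous[OF isometry_has_derivative[OF deckD(1)[OF k(1)] c(2)]] .
  then have "isCont (\<lambda>s. k (c s)) 0" by (rule isCont_o2[OF c(1)])
  then have "((\<lambda>s. k (c s)) \<longlongrightarrow> k (c 0)) (nhds 0)"
    by (simp add: isCont_def tendsto_nhds_iff)
  then have "\<forall>\<^sub>F s in nhds 0. dist (k (c s)) q0 < r"
    using r(1) k(2) by (simp add: tendstoD)
  with c(3) show ?thesis
    by eventually_elim (use r(2) deck_lift_set[OF k(1)] in blast)
qed

text \<open>
  Let \<open>f\<close> be the height function for which the horosphere at the start of the cord is \<open>f = ln z0\<close>. The
  initial covector is \<open>\<kappa>\<close> times the gradient of \<open>f\<close>, so \<open>f\<close> changes by \<open>\<kappa>\<close> along the cord, which has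
  energy \<open>\<kappa>^2 / 2\<close>. Since \<open>f \<le> ln z0\<close> on the preimage of the torus, this change is a drop. On
  the nearby paths \<open>f\<close> drops at least as much, because the cord ends at the point of the second
  horosphere where \<open>f\<close> is largest.
\<close>

lemma variation_minimal:
  assumes x: "x \<in> chords p T" and y: "chord_lift p x y" and C: "variation (lift_set p T) (\<lambda>t. fst (y t)) C"
  shows "\<forall>\<^sub>F s in nhds 0. energy (C 0) \<le> energy (C s)"
proof -
  let ?S = "lift_set p T"
  define q where "q = (\<lambda>t. fst (y t))"
  define \<xi> where "\<xi> = (\<lambda>t. snd (y t))"
  have fl: "geodesic_flow 1 q \<xi>" using chord_lift_flow[OF y] by (simp add: q_def \<xi>_def)
  have qH: "q t \<in> H3" if "t \<in> {0..1}" for t using fl that by (auto simp: geodesic_flow_def)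
  have con: "cot_class p (q t, \<xi> t) \<in> conormal p T" if "t = 0 \<or> t = 1" for t
  proof -
    have "x t = cot_class p (y t)" using y that by (auto simp: chord_lift_def)
    moreover have "x t \<in> conormal p T" using x that by (auto simp: chords_def)
    ultimately show ?thesis by (simp add: q_def \<xi>_def)
  qed
  obtain g0 a0 where g0: "g0 \<in> deck p" "a0 $ 3 = z0" "g0 a0 = q 0"
    "\<And>v. v $ 3 = 0 \<Longrightarrow> \<xi> 0 \<bullet> frechet_derivative g0 (at a0) v = 0"
    using conormal_orthogonal_horosphere[OF qH con, of 0] by auto
  obtain g1 a1 where g1: "g1 \<in> deck p" "a1 $ 3 = z0" "g1 a1 = q 1"
    "\<And>v. v $ 3 = 0 \<Longrightarrow> \<xi> 1 \<bullet> frechet_derivative g1 (at a1) v = 0"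
    using conormal_orthogonal_horosphere[OF qH con, of 1] by auto
  have aH: "a0 \<in> H3" "a1 \<in> H3" using g0(2) g1(2) z0 by auto
  obtain k0 where k0: "k0 \<in> deck p" "\<And>q. q \<in> H3 \<Longrightarrow> k0 (g0 q) = q" "\<And>q. q \<in> H3 \<Longrightarrow> g0 (k0 q) = q"
    using deck_inv[OF g0(1)] by blast
  obtain k1 where k1: "k1 \<in> deck p" "\<And>q. q \<in> H3 \<Longrightarrow> k1 (g1 q) = q" "\<And>q. q \<in> H3 \<Longrightarrow> g1 (k1 q) = q"
    using deck_inv[OF g1(1)] by blast
  define f where "f = log_height k0"
  define n where "n = grad_log_height k0"
  obtain N where e: "eikonal f n N" using eikonal_log_height[OF deckD(1)[OF k0(1)]] by (auto simp: f_def n_def)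
  obtain \<kappa> where \<kappa>: "\<xi> 0 = \<kappa> *\<^sub>R n (q 0)"
    using covector_orthogonal_to_horosphere[OF deckD(1)[OF g0(1)] deckD(1)[OF k0(1)] k0(2) aH(1) g0(4)]
    by (auto simp: n_def g0(3))
  note char = eikonal_characteristic[OF e fl \<kappa>]
  have f0: "f (q 0) = ln z0" using k0(2)[OF aH(1)] g0(2,3) by (simp add: f_def log_height_def)
  have f1: "f (q 1) = ln z0 + \<kappa>" using char(2)[of 1] f0 by simp
  have f_le: "f s \<le> ln z0" if "s \<in> ?S" for s
    unfolding f_def by (rule log_height_lift_set_le[OF k0(1) that])
  \<comment> \<open>The length of the cord.\<close>
  define L where "L = - \<kappa>"
  have "q 1 \<in> ?S" using deck_horosphere_in_lift_set[OF g1(1,2)] g1(3) by simp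
  then have L: "L \<ge> 0" using f_le f1 by (fastforce simp: L_def)
  have far: "f (g1 a2) \<le> ln z0 - L" if a2: "a2 $ 3 = z0" for a2
    unfolding f_def
  proof (rule far_horosphere_height_le[OF k0(1) g1(1,2) a2 L])
    show "log_height k0 (g1 a1) = ln z0 - L" using f1 by (simp add: f_def g1(3) L_def)
    fix v :: "real^3" assume v: "v $ 3 = 0" and "L \<noteq> 0"
    have "\<kappa> * (n (q 1) \<bullet> frechet_derivative g1 (at a1) v) = 0" using g1(4)[OF v] char(1)[of 1] by simp
    then show "grad_log_height k0 (g1 a1) \<bullet> frechet_derivative g1 (at a1) v = 0"
      using \<open>L \<noteq> 0\<close> by (simp add: L_def n_def g1(3))
  qed
  obtain d F where dF: "d > 0" "smooth_on ({-d<..<d} \<times> {0..1}) F" "F = (\<lambda>(s, t). C s t)"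
    "\<And>s t. s \<in> {-d<..<d} \<Longrightarrow> t \<in> {0..1} \<Longrightarrow> C s t \<in> H3"
    "\<And>s. s \<in> {-d<..<d} \<Longrightarrow> C s 0 \<in> ?S" "\<And>s. s \<in> {-d<..<d} \<Longrightarrow> C s 1 \<in> ?S"
    using variation_tube[OF C] by blast
  have C0: "C 0 t = q t" if "t \<in> {0..1}" for t using C that by (simp add: variation_def q_def)
  have ev: "\<forall>\<^sub>F s in nhds 0. C s t \<in> ?S" if "t = 0 \<or> t = 1" for t
  proof -
    have "\<forall>\<^sub>F s in nhds 0. s \<in> {-d<..<d}" using dF(1) by (intro eventually_nhds_in_open) auto
    then show ?thesis by eventually_elim (use dF(5,6) that in blast)
  qed
  have cont: "isCont (\<lambda>s. C s t) 0" if "t \<in> {0..1}" for t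
  proof -
    have "((\<lambda>s. C s t) has_vector_derivative frechet_derivative F (at (0, t)) (1, 0)) (at 0)"
      using smooth_on_partials(1)[OF dF(2), of 0 t] that dF(1) by (simp add: dF(3))
    then show ?thesis by (rule has_vector_derivative_continuous)
  qed
  have path: "(C s has_vector_derivative frechet_derivative F (at (s, t)) (0, 1)) (at t)"
    if "s \<in> {-d<..<d}" "t \<in> {0..1}" for s t
    using smooth_on_partials(2)[OF dF(2), of s t] that by (simp add: dF(3))
  have E0: "energy (C 0) = L\<^sup>2 / 2" using energy_characteristic[OF e fl \<kappa> C0] by (simp add: L_def)
  have "k0 (q 0) = a0" "k1 (q 1) = a1" using k0(2)[OF aH(1)] k1(2)[OF aH(2)] g0(3) g1(3) by simp_all
  then have "\<forall>\<^sub>F s in nhds 0. k0 (C s 0) $ 3 = z0" "\<forall>\<^sub>F s in nhds 0. k1 (C s 1) $ 3 = z0"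
    using curve_stays_on_horosphere[OF k0(1) _ g0(2), of "\<lambda>s. C s 0"]
      curve_stays_on_horosphere[OF k1(1) _ g1(2), of "\<lambda>s. C s 1"]
      cont[of 0] cont[of 1] C0[of 0] C0[of 1] qH[of 0] qH[of 1] ev[of 0] ev[of 1] by simp_all
  moreover have "\<forall>\<^sub>F s in nhds 0. s \<in> {-d<..<d}" using dF(1) by (intro eventually_nhds_in_open) auto
  ultimately show ?thesis
  proof eventually_elim
    case (elim s)
    have "f (C s 0) = ln z0" using elim(1) by (simp add: f_def log_height_def)
    moreover have "f (C s 1) \<le> ln z0 - L"
      using far[OF elim(2)] k1(3)[OF dF(4)[OF elim(3), of 1]] by simp
    moreover have "continuous_on {0..1} (\<lambda>t. frechet_derivative F (at (s, t)) (0, 1))"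
      by (rule continuous_on_compose2[OF smooth_on_imp_continuous_on[OF smooth_on_deriv[OF dF(2)]]])
         (use elim(3) in \<open>auto intro!: continuous_intros\<close>)
    ultimately have "L\<^sup>2 / 2 \<le> energy (C s)"
      using energy_lower_bound[OF e dF(4)[OF elim(3)] path[OF elim(3)]] L by simp
    then show ?case by (simp add: E0)
  qed
qed

text \<open>
  If a space of variation fields on which the Hessian is negative definite had a basis of \<open>m > 0\<close>
  elements, the sum of this basis would have negative second variation.
\<close>

lemma chord_index_eq_0:
  assumes x: "x \<in> chords p T"
  shows "chord_index p T x = 0"
proof -
  have "m = 0" if y: "chord_lift p x y" and V: "neg_def_family (lift_set p T) (fst \<circ> y) m V" for m y V
  proof (rule ccontr)
    assume "m \<noteq> 0"
    then have "\<exists>i<m. (\<lambda>i. 1::real) i \<noteq> 0" by auto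
    then obtain D where D: "D < 0" "has_second_variation (lift_set p T) (fst \<circ> y) (\<lambda>t. \<Sum>i<m. 1 *\<^sub>R V i t) D"
      using V unfolding neg_def_family_def by meson
    then obtain C where C: "variation (lift_set p T) (fst \<circ> y) C" "D = deriv (deriv (\<lambda>s. energy (C s))) 0"
      unfolding has_second_variation_def by blast
    have "\<forall>\<^sub>F s in nhds 0. energy (C 0) \<le> energy (C s)"
      using variation_minimal[OF x y] C(1) by (simp add: o_def)
    from second_variation_nonneg[OF C(1) this] show False using C(2) D(1) by simp
  qed
  then have "chord_index p T x \<le> 0" unfolding chord_index_def
    by (intro Sup_least) (auto simp: zero_enat_def)
  then show ?thesis by simp
qed

end

section \<open>Vanishing of the operations\<close>

text \<open>
  With all indices zero, an output requires \<open>length xs = 2\<close>.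
\<close>

lemma m_gen_eq_0:
  assumes ind: "\<And>x. x \<in> nonconst_chords p T \<Longrightarrow> chord_index p T x = 0"
    and xs: "set xs \<subseteq> nonconst_chords p T" and len: "length xs \<noteq> 2"
  shows "m_gen p T J D sg xs = 0"
proof -
  have "map (chord_index p T) xs = map (\<lambda>_. 0) xs" using ind xs by auto
  then have sum: "sum_list (map (chord_index p T) xs) = 0"
    by (simp only: map_replicate_const sum_list_replicate mult_zero_right)
  have "x0 \<notin> outputs p T J D sg xs" for x0
  proof
    assume x0: "x0 \<in> outputs p T J D sg xs"
    then have "chord_index p T x0 + enat (length xs) = 0 + 2" unfolding outputs_def sum by blast
    moreover have "chord_index p T x0 = 0" using x0 by (intro ind) (simp add: outputs_def)
    ultimately show False using len by (simp add: numeral_eq_enat)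
  qed
  then have "outputs p T J D sg xs = {}" by blast
  then show ?thesis by (simp add: m_gen_def)
qed

lemma in_listset_iff: "xs \<in> listset As \<longleftrightarrow> list_all2 (\<in>) xs As"
proof (induction As arbitrary: xs)
  case (Cons A As)
  then show ?case by (auto simp: set_Cons_def list_all2_Cons2)
qed simp

theorem theorem1p3:
  fixes M K T :: "'m::t2_space set"
    and A :: "('m set \<times> ('m \<Rightarrow> real^3)) set"
    and p :: "real^3 \<Rightarrow> 'm"
    and D :: "real list \<Rightarrow> floer_datum"
  assumes "closed_oriented_3manifold M A"
    and "hyperbolic_knot M A K p"
    and "horo_torus p T"
    and "floer_data D"
  shows "\<exists>C n e. compact C \<and> C \<subseteq> cotH3 \<and> e > 0 \<and>
    (\<forall>J\<in>J_h_nhd p C n e. \<forall>sg. sign_choice sg \<longrightarrow>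
      (\<forall>k\<ge>1. k \<noteq> 2 \<longrightarrow>
        (\<forall>fs. length fs = k \<and> set fs \<subseteq> reduced_CW p T \<longrightarrow> m_tilde p T J D sg fs = 0)))"
proof -
  obtain z0 a b where z0: "z0 > 0" "T = p ` {q. q $ 3 = z0}" "a $ 3 = 0" "b $ 3 = 0" "a \<noteq> b" "independent {a, b}"
    "\<forall>q\<in>H3. p (q + a) = p q \<and> p (q + b) = p q"
    "\<forall>g\<in>deck p. (\<exists>q. q $ 3 \<ge> z0 \<and> g q $ 3 \<ge> z0) \<longrightarrow>
            (\<exists>m n :: int. \<forall>q\<in>H3. g q = q + of_int m *\<^sub>R a + of_int n *\<^sub>R b)"
    using assms(3) unfolding horo_torus_def by blast
  interpret horo_torus_cover p "M - K" T z0 a b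
    by unfold_locales (use z0 assms(2) in \<open>auto simp: hyperbolic_knot_def simp del: in_H3\<close>)
  have ind: "chord_index p T x = 0" if "x \<in> nonconst_chords p T" for x
    using that by (intro chord_index_eq_0) (simp add: nonconst_chords_def)
  have "m_tilde p T J D sg fs = 0" if fs: "length fs \<noteq> 2" "set fs \<subseteq> reduced_CW p T" for J sg fs
    unfolding m_tilde_def
  proof (rule sum.neutral, rule ballI)
    fix xs assume "xs \<in> listset (map Poly_Mapping.keys fs)"
    then have xs: "length xs = length fs" "\<And>i. i < length fs \<Longrightarrow> xs ! i \<in> Poly_Mapping.keys (fs ! i)"
      by (auto simp: in_listset_iff list_all2_conv_all_nth)
    have "set xs \<subseteq> nonconst_chords p T"
    proof
      fix x assume "x \<in> set xs"
      then obtain i where i: "i < length fs" "x = xs ! i" by (metis in_set_conv_nth xs(1))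
      then have "fs ! i \<in> reduced_CW p T" using fs(2) by auto
      then show "x \<in> nonconst_chords p T"
        using xs(2)[OF i(1)] i(2) by (auto simp: reduced_CW_def)
    qed
    then have "m_gen p T J D sg xs = 0" using fs(1) xs(1) by (intro m_gen_eq_0 ind) auto
    then show "frag_cmul (\<Prod>j<length fs. Poly_Mapping.lookup (fs ! j) (xs ! j)) (m_gen p T J D sg xs) = 0" by simp
  qed
  \<comment> \<open>The count of degrees is the same for all compatible \<open>J\<close>, hence for those in the neighbourhood
    given by the empty compact set.\<close>
  then show ?thesis by (intro exI[of _ "{}"] exI[of _ 0] exI[of _ 1]) auto
qed

end
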